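(* In the setting of the context, let $\lambda_0,\lambda_1>0$. Let a group-sequential test $(\psi,\phi)\in\mathscr S_0$ be such that conditions $\mathfrak S_\infty(\psi)$ and $\mathfrak D(\psi,\phi)$ are satisfied. Then for all group-sequential tests $(\psi',\phi')\in\mathscr S_0$ such that $$\alpha(\psi',\phi')\le\alpha(\psi,\phi)\quad\text{and}\quad\beta(\psi',\phi')\le\beta(\psi,\phi)\qquad(1)$$ it holds $$K_0(\psi')\ge K_0(\psi).\qquad(2)$$ The inequality in (2) is strict if at least one of the inequalities in (1) is strict. If there are equalities in all the inequalities in (1) and (2), then conditions $\mathfrak S_\infty(\psi')$ and $\mathfrak D(\psi',\phi')$ are satisfied for $(\psi',\phi')$.
   Context: Setting. Observations arrive in groups $k=1,2,\dots$ of random sizes $\nu_1,\nu_2,\dots$, which are independent with values in $\mathscr G\subset\{0,1,2,\dots\}$ and known p.m.f.s $p_k(m)=P(\nu_k=m)$, $m\in\mathscr G$. For $n=(n_1,\dots,n_k)\in\mathscr G^k$ put $p(n)=\prod_{i=1}^kp_i(n_i)$, and $\mathcal P_k=\{n\in\mathscr G^k:p(n)>0\}$. Given the group sizes, all observations $X_{ij}$ ($j\le n_i$, $i\le k$) are i.i.d. with values in a measurable space $(\mathfrak X,\mathscr X)$ and density $f_\theta$ with respect to a $\sigma$-finite measure $\mu$, $\theta\in\{\theta_0,\theta_1\}$. Thus, given sizes $n$, the data $X^{(n)}=(X_1^{(n_1)},\dots,X_k^{(n_k)})$, $X_i^{(n_i)}=(X_{i1},\dots,X_{in_i})$, has density $f_\theta^{(n)}(x^{(n)})=\prod_{i=1}^k\prod_{j=1}^{n_i}f_\theta(x_{ij})$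 with respect to $\mu^n=\mu^{n_1}\otimes\cdots\otimes\mu^{n_k}$ on $\mathfrak X^n=\mathfrak X^{n_1}\times\cdots\times\mathfrak X^{n_k}$ (empty products are $1$; $\mathfrak X^0$ is a one-point space and $\mu^0$ a probability measure on it). For a function $F_n$ on $\mathfrak X^n$, $E_\theta F_n=\int F_nf_\theta^{(n)}d\mu^n$. Write $f_i,E_i,P_i$ for $f_{\theta_i},E_{\theta_i},P_{\theta_i}$, $i=0,1$. It is assumed that $\mu\{x:f_0(x)\ne f_1(x)\}>0$. Tests. A stopping rule $\psi$ is a family of measurable functions $\psi_n:\mathfrak X^n\to[0,1]$, $n\in\mathscr G^k$, $k\ge1$ (conditional probability of stopping after the observed groups); a decision rule $\phi$ is a family of measurable $\phi_n:\mathfrak X^n\to[0,1]$ (conditional probability of rejecting $H_0:\theta=\theta_0$ in favour of $H_1:\theta=\theta_1$). A group-sequential test is a pair $(\psi,\phi)$. For $n=(n_1,\dots,n_k)$ let $t_n^\psi(x^{(n)})=\prod_{i=1}^{k-1}\bigl(1-\psi_{(n_1,\dots,n_i)}(x_1^{(n_1)},\dots,x_i^{(n_i)})\bigr)$ (equal to $1$ for $k=1$), $s_n^\psi=t_n^\psi\psi_n$, $S_n^\psi=\{x^{(n)}:s_n^\psi(x^{(n)})>0\}$, $T_n^\psi=\{x^{(n)}:t_n^\psi(x^{(n)})>0\}$. $\mathscr F_0$ is the set of stopping rules with $\sum_{k\ge1}\sum_{n\in\mathscr G^k}p(n)E_0s_n^\psi=1$; $\mathscr S_0$ is the set of tests $(\psi,\phi)$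 with $\psi\in\mathscr F_0$. Error probabilities: $\alpha(\psi,\phi)=\sum_{k\ge1}\sum_{n\in\mathscr G^k}p(n)E_0s_n^\psi\phi_n$, $\beta(\psi,\phi)=\sum_{k\ge1}\sum_{n\in\mathscr G^k}p(n)E_1s_n^\psi(1-\phi_n)$. Costs: $c(m)>0$ for $m\in\mathscr G$; $c(n)=\sum_{i=1}^kc(n_i)$ for $n\in\mathscr G^k$; $\bar c_k=\sum_{m\in\mathscr G}p_k(m)c(m)$, assumed to satisfy $0<\bar c_k<\infty$ for all $k$. $K_0(\psi)=\sum_{k\ge1}\sum_{n\in\mathscr G^k}p(n)c(n)E_0s_n^\psi\in[0,\infty]$. Likelihood ratio: $z_n=f_1^{(n)}(x^{(n)})/f_0^{(n)}(x^{(n)})$ if $f_0^{(n)}(x^{(n)})>0$, $z_n=\infty$ if $f_0^{(n)}(x^{(n)})=0<f_1^{(n)}(x^{(n)})$, and $z_n=0$ (or any other value) otherwise. Let $g(z)=\min\{\lambda_0,\lambda_1z\}$, $z\ge0$. For $N\ge1$ define on $z\ge0$: $V_N^N(z)=g(z)$ and, for $k=N,N-1,\dots,2$, $V_{k-1}^N(z)=\min\{g(z),\ \bar c_k+\sum_{m\in\mathscr G}p_k(m)E_0V_k^N(zz_m)\}$; $\bar V_k^N(z)=\sum_{m\in\mathscr G}p_k(m)E_0V_k^N(zz_m)$, $1\le k\le N$ (here $z_m$ is the likelihood ratio of a single group of size $m$). For fixed $k$ these are nonincreasing in $N$; $\bar V_k(z)=\lim_{N\to\infty}\bar V_k^N(z)$.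 Notation: $\psi\simeq I_{\{F_1\preccurlyeq F_2\}}$ means $I_{\{F_1<F_2\}}\le\psi\le I_{\{F_1\le F_2\}}$. Condition $\mathfrak S_\infty(\psi)$: for all $k\ge1$ and all $n\in\mathcal P_k$, $\psi_n\simeq I_{\{g(z_n)\preccurlyeq\bar c_{k+1}+\bar V_{k+1}(z_n)\}}$ $P_0$-almost surely on $T_n^\psi$ (i.e. for $\mu^n$-almost every $x^{(n)}\in T_n^\psi\cap\{f_0^{(n)}>0\}$). Condition $\mathfrak D(\psi,\phi)$: for all $k\ge1$ and all $n\in\mathcal P_k$, $\phi_n\simeq I_{\{\lambda_0/\lambda_1\preccurlyeq z_n\}}$ $P_0$-almost surely on $S_n^\psi$.
   Formalization: Condition D is required both P_0- and P_1-almost surely on S_n, in hypothesis and conclusion; with P_0 only, φ_n is free where f_0^(n)=0<f_1^(n), so β can be lowered at equal α and K_0, and the strictness claim fails. *)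

theory Defs
  imports "HOL-Probability.Probability"
begin

text \<open>
  A vector of group sizes $n = (n_1,\dots,n_k)$ is a list; data $x^{(n)}$ are doubly indexed
  families. Positions are counted from 0, so \<open>n ! i\<close> is $n_{i+1}$, with p.m.f.\ \<open>p (Suc i)\<close>, and
  \<open>x i j\<close> is $x_{i+1,j+1}$. The value \<open>p 0\<close> plays no role.
\<close>

type_synonym 'a data = "nat \<Rightarrow> nat \<Rightarrow> 'a"

text \<open>Stopping rules and decision rules: one function on the data space for each \<open>n\<close>.\<close>

type_synonym 'a rule = "nat list \<Rightarrow> 'a data \<Rightarrow> real"

text \<open>The relation $\psi \simeq I_{\{F_1 \preccurlyeq F_2\}}$ at a point: \<open>\<psi>\<close> is arbitrary in case of a tie.\<close>

definition between_ind :: "real \<Rightarrow> ennreal \<Rightarrow> ennreal \<Rightarrow> bool" where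
  "between_ind \<psi> F1 F2 \<longleftrightarrow> of_bool (F1 < F2) \<le> \<psi> \<and> \<psi> \<le> of_bool (F1 \<le> F2)"

locale group_sequential = sigma_finite_measure M
  for M :: "'a measure" +
  fixes G :: "nat set"
    and p :: "nat \<Rightarrow> nat pmf"
    and f0 f1 :: "'a \<Rightarrow> real"
    and c :: "nat \<Rightarrow> real"
  assumes sizes_in_G: "\<And>k. k \<ge> 1 \<Longrightarrow> set_pmf (p k) \<subseteq> G"
    and f0_measurable: "f0 \<in> borel_measurable M"
    and f0_nonneg: "\<And>x. x \<in> space M \<Longrightarrow> 0 \<le> f0 x"
    and f0_density: "(\<integral>\<^sup>+ x. ennreal (f0 x) \<partial>M) = 1"
    and f1_measurable: "f1 \<in> borel_measurable M"
    and f1_nonneg: "\<And>x. x \<in> space M \<Longrightarrow> 0 \<le> f1 x"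
    and f1_density: "(\<integral>\<^sup>+ x. ennreal (f1 x) \<partial>M) = 1"
    and f0_f1_distinct: "emeasure M {x \<in> space M. f0 x \<noteq> f1 x} > 0"
    and cost_pos: "\<And>m. m \<in> G \<Longrightarrow> 0 < c m"
    and mean_cost: "\<And>k. k \<ge> 1 \<Longrightarrow>
          0 < (\<Sum>\<^sub>\<infinity>m\<in>G. ennreal (pmf (p k) m * c m)) \<and>
          (\<Sum>\<^sub>\<infinity>m\<in>G. ennreal (pmf (p k) m * c m)) < \<infinity>"
begin

definition sizes :: "nat \<Rightarrow> nat list set" where
  "sizes k = {n. length n = k \<and> set n \<subseteq> G}"

definition prob_sizes :: "nat list \<Rightarrow> real" where
  "prob_sizes n = (\<Prod>i<length n. pmf (p (Suc i)) (n ! i))"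

definition pos_sizes :: "nat \<Rightarrow> nat list set" where
  "pos_sizes k = {n \<in> sizes k. prob_sizes n > 0}"

definition cost :: "nat list \<Rightarrow> real" where
  "cost n = (\<Sum>i<length n. c (n ! i))"

definition mean_c :: "nat \<Rightarrow> ennreal" where
  "mean_c k = (\<Sum>\<^sub>\<infinity>m\<in>G. ennreal (pmf (p k) m * c m))"

text \<open>
  $\mu^n = \mu^{n_1}\otimes\cdots\otimes\mu^{n_k}$. A factor with \<open>n ! i = 0\<close> is the unit mass on
  the one-point space of functions with empty index set.
\<close>

definition mu :: "nat list \<Rightarrow> 'a data measure" where
  "mu n = (\<Pi>\<^sub>M i\<in>{..<length n}. \<Pi>\<^sub>M j\<in>{..<n ! i}. M)"

definition dens :: "('a \<Rightarrow> real) \<Rightarrow> nat list \<Rightarrow> 'a data \<Rightarrow> real" where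
  "dens f n x = (\<Prod>i<length n. \<Prod>j<n ! i. f (x i j))"

definition E :: "('a \<Rightarrow> real) \<Rightarrow> nat list \<Rightarrow> ('a data \<Rightarrow> ennreal) \<Rightarrow> ennreal" where
  "E f n F = (\<integral>\<^sup>+ x. F x * ennreal (dens f n x) \<partial>mu n)"

definition is_rule :: "'a rule \<Rightarrow> bool" where
  "is_rule \<psi> \<longleftrightarrow> (\<forall>k\<ge>1. \<forall>n\<in>sizes k.
     \<psi> n \<in> borel_measurable (mu n) \<and> (\<forall>x\<in>space (mu n). 0 \<le> \<psi> n x \<and> \<psi> n x \<le> 1))"

definition t :: "'a rule \<Rightarrow> nat list \<Rightarrow> 'a data \<Rightarrow> real" where
  "t \<psi> n x = (\<Prod>i\<in>{1..<length n}. 1 - \<psi> (take i n) (restrict x {..<i}))"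

definition s :: "'a rule \<Rightarrow> nat list \<Rightarrow> 'a data \<Rightarrow> real" where
  "s \<psi> n x = t \<psi> n x * \<psi> n x"

definition T_set :: "'a rule \<Rightarrow> nat list \<Rightarrow> 'a data set" where
  "T_set \<psi> n = {x \<in> space (mu n). t \<psi> n x > 0}"

definition S_set :: "'a rule \<Rightarrow> nat list \<Rightarrow> 'a data set" where
  "S_set \<psi> n = {x \<in> space (mu n). s \<psi> n x > 0}"

definition stopping_rules0 :: "'a rule set" where
  "stopping_rules0 = {\<psi>. is_rule \<psi> \<and>
     (\<Sum>\<^sub>\<infinity>k\<in>{1..}. \<Sum>\<^sub>\<infinity>n\<in>sizes k.
        ennreal (prob_sizes n) * E f0 n (\<lambda>x. ennreal (s \<psi> n x))) = 1}"

definition tests0 :: "('a rule \<times> 'a rule) set" where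
  "tests0 = {(\<psi>, \<phi>). \<psi> \<in> stopping_rules0 \<and> is_rule \<phi>}"

definition \<alpha> :: "'a rule \<Rightarrow> 'a rule \<Rightarrow> ennreal" where
  "\<alpha> \<psi> \<phi> = (\<Sum>\<^sub>\<infinity>k\<in>{1..}. \<Sum>\<^sub>\<infinity>n\<in>sizes k.
     ennreal (prob_sizes n) * E f0 n (\<lambda>x. ennreal (s \<psi> n x * \<phi> n x)))"

definition \<beta> :: "'a rule \<Rightarrow> 'a rule \<Rightarrow> ennreal" where
  "\<beta> \<psi> \<phi> = (\<Sum>\<^sub>\<infinity>k\<in>{1..}. \<Sum>\<^sub>\<infinity>n\<in>sizes k.
     ennreal (prob_sizes n) * E f1 n (\<lambda>x. ennreal (s \<psi> n x * (1 - \<phi> n x))))"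

definition K0 :: "'a rule \<Rightarrow> ennreal" where
  "K0 \<psi> = (\<Sum>\<^sub>\<infinity>k\<in>{1..}. \<Sum>\<^sub>\<infinity>n\<in>sizes k.
     ennreal (prob_sizes n * cost n) * E f0 n (\<lambda>x. ennreal (s \<psi> n x)))"

definition z :: "nat list \<Rightarrow> 'a data \<Rightarrow> ennreal" where
  "z n x = (if dens f0 n x > 0 then ennreal (dens f1 n x / dens f0 n x)
            else if dens f1 n x > 0 then \<infinity> else 0)"

text \<open>
  Here \<open>l0\<close>, \<open>l1\<close> are $\lambda_0$, $\lambda_1$. The functions of $z \ge 0$ are extended to
  $[0,\infty]$ because \<open>z n\<close> may be infinite. Under the null hypothesis that happens with
  probability zero, so the values at infinity do not affect the integrals below.
\<close>

definition g :: "real \<Rightarrow> real \<Rightarrow> ennreal \<Rightarrow> ennreal" where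
  "g l0 l1 y = min (ennreal l0) (ennreal l1 * y)"

text \<open>\<open>V l0 l1 N k\<close> is $V_k^N$ for $1 \le k \le N$. For \<open>k > N\<close> its value is irrelevant.\<close>

function V :: "real \<Rightarrow> real \<Rightarrow> nat \<Rightarrow> nat \<Rightarrow> ennreal \<Rightarrow> ennreal" where
  "V l0 l1 N k y =
     (if N \<le> k then g l0 l1 y
      else min (g l0 l1 y)
             (mean_c (Suc k) + (\<Sum>\<^sub>\<infinity>m\<in>G. ennreal (pmf (p (Suc k)) m) *
                E f0 [m] (\<lambda>x. V l0 l1 N (Suc k) (y * z [m] x)))))"
  by auto
termination by (relation "Wellfounded.measure (\<lambda>(_, _, N, k, _). N - k)") auto

declare V.simps [simp del]

definition Vbar_trunc :: "real \<Rightarrow> real \<Rightarrow> nat \<Rightarrow> nat \<Rightarrow> ennreal \<Rightarrow> ennreal" where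
  "Vbar_trunc l0 l1 N k y =
     (\<Sum>\<^sub>\<infinity>m\<in>G. ennreal (pmf (p k) m) * E f0 [m] (\<lambda>x. V l0 l1 N k (y * z [m] x)))"

definition Vbar :: "real \<Rightarrow> real \<Rightarrow> nat \<Rightarrow> ennreal \<Rightarrow> ennreal" where
  "Vbar l0 l1 k y = lim (\<lambda>N. Vbar_trunc l0 l1 N k y)"

text \<open>\<open>Q\<close> holds almost surely on \<open>A\<close> under the distribution of the data with density \<open>dens f n\<close>.\<close>

definition as_on :: "('a \<Rightarrow> real) \<Rightarrow> nat list \<Rightarrow> 'a data set \<Rightarrow> ('a data \<Rightarrow> bool) \<Rightarrow> bool" where
  "as_on f n A Q \<longleftrightarrow> (AE x in mu n. x \<in> A \<and> dens f n x > 0 \<longrightarrow> Q x)"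

definition cond_S :: "real \<Rightarrow> real \<Rightarrow> 'a rule \<Rightarrow> bool" where
  "cond_S l0 l1 \<psi> \<longleftrightarrow> (\<forall>k\<ge>1. \<forall>n\<in>pos_sizes k. as_on f0 n (T_set \<psi> n)
     (\<lambda>x. between_ind (\<psi> n x) (g l0 l1 (z n x)) (mean_c (Suc k) + Vbar l0 l1 (Suc k) (z n x))))"

text \<open>
  The decision condition, almost surely with respect to density \<open>f\<close>. For \<open>f = f0\<close> it says nothing
  about data with $f_0^{(n)} = 0 < f_1^{(n)}$, where $z_n = \infty$. Such data contribute to the
  type II error unless the null hypothesis is rejected there, which is what the condition for
  \<open>f = f1\<close> adds. If \<open>f1\<close> vanishes almost everywhere where \<open>f0\<close> does, the condition for \<open>f0\<close>
  implies the one for \<open>f1\<close>.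
\<close>

definition cond_D :: "('a \<Rightarrow> real) \<Rightarrow> real \<Rightarrow> real \<Rightarrow> 'a rule \<Rightarrow> 'a rule \<Rightarrow> bool" where
  "cond_D f l0 l1 \<psi> \<phi> \<longleftrightarrow> (\<forall>k\<ge>1. \<forall>n\<in>pos_sizes k. as_on f n (S_set \<psi> n)
     (\<lambda>x. between_ind (\<phi> n x) (ennreal (l0 / l1)) (z n x)))"

end

end

theory Submission
  imports Defs
begin

text \<open>
  The test minimising $K_0 + \lambda_0\alpha + \lambda_1\beta$ minimises $K_0$ under the constraints on the
  error probabilities. Pointwise, $\lambda_0\phi_n f_0^{(n)} + \lambda_1(1-\phi_n)f_1^{(n)} \ge
  \min\{\lambda_0f_0^{(n)}, \lambda_1f_1^{(n)}\} = g(z_n)f_0^{(n)}$ on the set where one stops, with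
  equality exactly under the decision condition; this leaves a stopping problem under the null
  hypothesis with terminal cost $g(z_n)$. Let $V_k = \lim_N V_k^N$, so that
  $V_k = \min\{g, \bar c_{k+1} + \bar V_{k+1}\}$, and let $R_k$ be the expectation of
  $c(n) + V_k(z_n)$ over the paths that reach stage $k$. Replacing the minimum by its mixture with
  weights $\psi_n$ and $1 - \psi_n$ shows that $R_k$ is at most the expected loss of the paths stopped
  at stage $k$ plus $R_{k+1}$, with equality exactly under the stopping condition. Under that
  condition, the loss of the test is thus at most $R_1$. For any test with finite $K_0$, $R_k$ tends
  to 0, because the expected cost of the paths reaching stage $k$ is bounded by a tail of the series
  $K_0$; hence its loss is at least $R_1$, and equality forces all conditions.
\<close>

section \<open>Sums and integrals with values in the extended nonnegative reals\<close>

lemma infsum_ennreal_eq_nn_integral: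
  fixes f :: "'b \<Rightarrow> ennreal"
  assumes "countable A"
  shows "infsum f A = (\<integral>\<^sup>+x. f x \<partial>count_space A)"
proof -
  have nat: "infsum h B = (\<integral>\<^sup>+x. h x \<partial>count_space B)" for h :: "nat \<Rightarrow> ennreal" and B
  proof -
    have "infsum h B = infsum (\<lambda>x. h x * indicator B x) UNIV"
      by (rule infsum_cong_neutral) auto
    also have "\<dots> = (\<Sum>x. h x * indicator B x)"
      by (intro sums_unique has_sum_imp_sums has_sum_infsum) (rule nonneg_summable_on_complete, simp)
    also have "\<dots> = (\<integral>\<^sup>+x. h x \<partial>count_space B)"
      by (cases "B = UNIV") (simp_all add: nn_integral_count_space_nat nn_integral_count_space_indicator)
    finally show ?thesis .
  qed
  \<comment> \<open>The unordered sum and the counting integral agree on sets of naturals, where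
    both are series; the enumeration of \<open>A\<close> carries this over to any countable index
    set.\<close>
  let ?e = "to_nat_on A"
  have bij: "bij_betw (from_nat_into A) (?e ` A) A"
    using assms by (intro bij_betwI[where g = ?e]) auto
  show ?thesis
    using nat[of "\<lambda>i. f (from_nat_into A i)" "?e ` A"]
      infsum_reindex_bij_betw[OF bij, of f] nn_integral_bij_count_space[OF bij, of f] by simp
qed

lemma infsum_atLeast_1:
  fixes f :: "nat \<Rightarrow> ennreal"
  shows "(\<Sum>\<^sub>\<infinity>k\<in>{1..}. f k) = (\<Sum>k. f (Suc k))"
proof -
  have "bij_betw Suc UNIV {1..}"
    by (intro bij_betwI[where g = "\<lambda>k. k - 1"]) auto
  then have "(\<Sum>\<^sub>\<infinity>k\<in>{1..}. f k) = (\<Sum>\<^sub>\<infinity>k. f (Suc k))"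
    by (rule infsum_reindex_bij_betw[symmetric])
  then show ?thesis
    by (simp add: infsum_ennreal_eq_nn_integral nn_integral_count_space_nat)
qed

text \<open>A strict inequality on a set of positive measure would make the integrals differ,
  because they are finite. Every deduction of a pointwise condition from equality of risks goes
  through this fact.\<close>

lemma nn_integral_eq_imp_AE_eq:
  fixes F H :: "'b \<Rightarrow> ennreal"
  assumes [measurable]: "F \<in> borel_measurable N" "H \<in> borel_measurable N"
    and "AE x in N. F x \<le> H x" "(\<integral>\<^sup>+x. F x \<partial>N) = (\<integral>\<^sup>+x. H x \<partial>N)" "(\<integral>\<^sup>+x. F x \<partial>N) < \<infinity>"
  shows "AE x in N. F x = H x"
proof -
  have "AE x in N. H x \<le> F x"
  proof (rule ccontr)
    assume "\<not> (AE x in N. H x \<le> F x)"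
    then have "(\<integral>\<^sup>+x. F x \<partial>N) < (\<integral>\<^sup>+x. H x \<partial>N)"
      using assms by (intro nn_integral_less) auto
    then show False using assms by simp
  qed
  with assms(3) show ?thesis by eventually_elim auto
qed

lemma nn_integral_count_space_eq_indicator:
  fixes f :: "'b \<Rightarrow> ennreal"
  shows "(\<integral>\<^sup>+x. f x \<partial>count_space X) = (\<integral>\<^sup>+x. f x * indicator X x \<partial>count_space UNIV)"
  by (simp add: nn_integral_restrict_space[symmetric] restrict_count_space)

lemma nn_integral_count_space_Times:
  fixes h :: "'b \<times> 'c \<Rightarrow> ennreal"
  shows "(\<integral>\<^sup>+u. h u \<partial>count_space (A \<times> B)) = (\<integral>\<^sup>+a. \<integral>\<^sup>+b. h (a, b) \<partial>count_space B \<partial>count_space A)"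
proof -
  note eq = nn_integral_count_space_eq_indicator
  have "(\<integral>\<^sup>+u. h u \<partial>count_space (A \<times> B)) =
      (\<integral>\<^sup>+a. \<integral>\<^sup>+b. h (a, b) * indicator (A \<times> B) (a, b) \<partial>count_space UNIV \<partial>count_space UNIV)"
    unfolding eq[where f = h]
    by (rule nn_integral_fst_count_space[of "\<lambda>u. h u * indicator (A \<times> B) u", symmetric])
  also have "\<dots> = (\<integral>\<^sup>+a. (\<integral>\<^sup>+b. h (a, b) * indicator B b \<partial>count_space UNIV) * indicator A a \<partial>count_space UNIV)"
    by (intro nn_integral_cong) (auto simp: indicator_times split: split_indicator)
  finally show ?thesis unfolding eq[where X = B] eq[where X = A] .
qed

text \<open>A tail is the whole sum minus a partial sum. Finiteness of the sum is what makes this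
  subtraction legitimate.\<close>

lemma ennreal_suminf_tail_tendsto_0:
  fixes f :: "nat \<Rightarrow> ennreal"
  assumes "(\<Sum>j. f j) < \<infinity>"
  shows "(\<lambda>k. \<Sum>j. f (j + k)) \<longlonglongrightarrow> 0"
proof -
  have "(\<Sum>j<k. f j) + (\<Sum>j. f (j + k)) = (\<Sum>j. f j)" for k
    using suminf_offset[of f k] by (simp add: add.commute)
  moreover have "(\<Sum>j<k. f j) < \<infinity>" for k
    using assms sum_le_suminf[of f "{..<k}"] by (simp add: order.strict_trans1)
  ultimately have "(\<Sum>j. f (j + k)) = (\<Sum>j. f j) - (\<Sum>j<k. f j)" for k
    by (metis ennreal_add_diff_cancel_left less_irrefl infinity_ennreal_def)
  moreover have "(\<lambda>k. (\<Sum>j. f j) - (\<Sum>j<k. f j)) \<longlonglongrightarrow> (\<Sum>j. f j) - (\<Sum>j. f j)"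
    using assms by (intro tendsto_diff_ennreal tendsto_const summable_LIMSEQ) auto
  ultimately show ?thesis using assms by simp
qed

lemma ennreal_suminf_eq_imp_eq:
  fixes f h :: "nat \<Rightarrow> ennreal"
  assumes "\<And>k. f k \<le> h k" "(\<Sum>k. f k) = (\<Sum>k. h k)" "(\<Sum>k. f k) < \<infinity>"
  shows "f k = h k"
  using nn_integral_eq_imp_AE_eq[of f "count_space UNIV" h] assms
  by (simp add: nn_integral_count_space_nat AE_count_space)

text \<open>The weight \<open>r\<close> splits into \<open>r * q\<close> and
  \<open>r * (1 - q)\<close>, and the minimum is at most either alternative. Applied twice: with
  \<open>q\<close> the stopping probability (stop or continue) and with \<open>q\<close> the
  rejection probability (reject or accept); \<open>e\<close> is the cost common to both
  alternatives.\<close>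

lemma min_le_mix:
  fixes r q :: real and a b e :: ennreal
  assumes "0 \<le> r" "0 \<le> q" "q \<le> 1"
  shows "ennreal r * (e + min a b) \<le> ennreal (r * q) * (e + a) + ennreal (r * (1 - q)) * (e + b)"
proof -
  have "ennreal r * (e + min a b) = ennreal (r * q + r * (1 - q)) * (e + min a b)"
    by (simp add: algebra_simps)
  also have "\<dots> = ennreal (r * q) * (e + min a b) + ennreal (r * (1 - q)) * (e + min a b)"
    using assms by (subst ennreal_plus) (auto simp: distrib_right)
  also have "\<dots> \<le> ennreal (r * q) * (e + a) + ennreal (r * (1 - q)) * (e + b)"
    by (intro add_mono mult_left_mono) auto
  finally show ?thesis .
qed

text \<open>The gap between the two sides is \<open>r\<close> times \<open>(1 - q) * (b - a)\<close>
  if \<open>a \<le> b\<close>, and \<open>r\<close> times \<open>q * (a - b)\<close> otherwise. It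
  vanishes exactly when \<open>q\<close> puts no weight on the strictly worse alternative.
  Finiteness and \<open>0 < r\<close> allow the cancellations.\<close>

lemma min_eq_mix_iff:
  fixes r q :: real and a b e :: ennreal
  assumes "0 < r" "0 \<le> q" "q \<le> 1" and fin: "a < \<infinity>" "b < \<infinity>" "e < \<infinity>"
  shows "ennreal r * (e + min a b) = ennreal (r * q) * (e + a) + ennreal (r * (1 - q)) * (e + b)
    \<longleftrightarrow> between_ind q a b"
proof -
  obtain a' b' e' where *: "a = ennreal a'" "b = ennreal b'" "e = ennreal e'" "0 \<le> a'" "0 \<le> b'" "0 \<le> e'"
    using fin by (cases a; cases b; cases e) auto
  have "ennreal r * (e + min a b) = ennreal (r * (e' + min a' b'))"
    using * assms by (auto simp: min_def ennreal_mult)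
  moreover have "ennreal (r * q) * (e + a) + ennreal (r * (1 - q)) * (e + b) =
      ennreal (r * q * (e' + a') + r * (1 - q) * (e' + b'))"
    using * assms by (simp add: ennreal_mult)
  ultimately have "ennreal r * (e + min a b) = ennreal (r * q) * (e + a) + ennreal (r * (1 - q)) * (e + b)
    \<longleftrightarrow> r * (e' + min a' b') = r * q * (e' + a') + r * (1 - q) * (e' + b')"
    using * assms by (simp only:) (intro ennreal_inj; simp)
  also have "\<dots> \<longleftrightarrow> r * (e' + min a' b' - q * (e' + a') - (1 - q) * (e' + b')) = 0"
    by (simp add: algebra_simps)
  also have "\<dots> \<longleftrightarrow> e' + min a' b' - q * (e' + a') - (1 - q) * (e' + b') = 0"
    using assms(1) by simp
  also have "\<dots> \<longleftrightarrow> min a' b' = q * a' + (1 - q) * b'"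
    by (auto simp: algebra_simps)
  also have "\<dots> \<longleftrightarrow> (if a' \<le> b' then (1 - q) * (b' - a') = 0 else q * (a' - b') = 0)"
    by (auto simp: min_def algebra_simps)
  also have "\<dots> \<longleftrightarrow> between_ind q a b"
    using * assms by (auto simp: between_ind_def ennreal_less_iff)
  finally show ?thesis .
qed

context group_sequential
begin

subsection \<open>Integration over one more group\<close>

abbreviation nu :: "nat \<Rightarrow> (nat \<Rightarrow> 'a) measure" where
  "nu m \<equiv> \<Pi>\<^sub>M j\<in>{..<m}. M"

lemma sigma_finite_nu: "sigma_finite_measure (nu m)"
proof -
  interpret product_sigma_finite "\<lambda>_::nat. M"
    by unfold_locales
  show ?thesis by (rule sigma_finite) simp
qed

lemma product_sigma_finite_nu: "product_sigma_finite (\<lambda>i. nu (n i))"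
  using sigma_finite_nu by (simp add: product_sigma_finite_def)

lemma space_mu: "space (mu n) = (\<Pi>\<^sub>E i\<in>{..<length n}. \<Pi>\<^sub>E j\<in>{..<n ! i}. space M)"
  by (simp add: mu_def space_PiM)

lemma mu_eq_PiM: "i \<le> length n \<Longrightarrow> mu (take i n) = (\<Pi>\<^sub>M i\<in>{..<i}. nu (n ! i))"
  unfolding mu_def by (intro PiM_cong) auto

lemma mu_snoc: "mu (n @ [m]) = (\<Pi>\<^sub>M i\<in>insert (length n) {..<length n}. nu ((n @ [m]) ! i))"
  unfolding mu_def by (intro PiM_cong) (auto simp: less_Suc_eq)

lemma mu_single: "mu [m] = (\<Pi>\<^sub>M i\<in>{0}. nu m)"
  unfolding mu_def by (intro PiM_cong) auto

lemma measurable_restrict_mu [measurable (raw)]: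
  "i \<le> length n \<Longrightarrow> (\<lambda>x. restrict x {..<i}) \<in> mu n \<rightarrow>\<^sub>M mu (take i n)"
  unfolding mu_eq_PiM by (subst mu_def) (intro measurable_restrict_subset, auto)

lemma measurable_snoc:
  "(\<lambda>(x, y). x(length n := y)) \<in> mu n \<Otimes>\<^sub>M nu m \<rightarrow>\<^sub>M mu (n @ [m])"
proof -
  have "mu n = (\<Pi>\<^sub>M i\<in>{..<length n}. nu ((n @ [m]) ! i))"
    using mu_eq_PiM[of "length n" "n @ [m]"] by simp
  then show ?thesis
    using measurable_add_dim[of "length n" "{..<length n}" "\<lambda>i. nu ((n @ [m]) ! i)"]
    by (simp add: mu_snoc)
qed

lemma dens_nonneg:
  assumes "\<And>x. x \<in> space M \<Longrightarrow> 0 \<le> f x" "x \<in> space (mu n)"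
  shows "0 \<le> dens f n x"
  unfolding dens_def using assms by (intro prod_nonneg) (auto simp: space_mu PiE_iff)

lemma dens_measurable [measurable]:
  assumes [measurable]: "f \<in> borel_measurable M"
  shows "dens f n \<in> borel_measurable (mu n)"
proof -
  have [measurable]: "(\<lambda>x. x i j) \<in> mu n \<rightarrow>\<^sub>M M" if "i < length n" "j < n ! i" for i j
    unfolding mu_def using that
    by (intro measurable_compose[OF measurable_component_singleton[of i]] measurable_component_singleton[of j]) auto
  show ?thesis
    unfolding dens_def by measurable
qed

text \<open>Data for the one-group vector \<open>[m]\<close> are still doubly indexed, with their
  only group at index 0. Hence \<open>y 0\<close> is the group appended to \<open>x\<close>, here
  and below.\<close>

lemma dens_snoc:
  "dens f (n @ [m]) (x(length n := y 0)) = dens f n x * dens f [m] y"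
proof -
  have "(\<Prod>i<length n. \<Prod>j<(n @ [m]) ! i. f ((x(length n := y 0)) i j)) = dens f n x"
    unfolding dens_def by (intro prod.cong) (auto simp: nth_append)
  then show ?thesis
    by (simp add: dens_def[of f "n @ [m]"] dens_def[of f "[m]"])
qed

lemma f0_dens_nonneg [simp]: "x \<in> space (mu n) \<Longrightarrow> 0 \<le> dens f0 n x"
  and f1_dens_nonneg [simp]: "x \<in> space (mu n) \<Longrightarrow> 0 \<le> dens f1 n x"
  using f0_nonneg f1_nonneg by (auto intro: dens_nonneg)

lemmas [measurable] = f0_measurable f1_measurable

lemma z_measurable [measurable]: "z n \<in> borel_measurable (mu n)"
  unfolding z_def by measurable

lemma E_single:
  assumes [measurable]: "H \<in> borel_measurable (nu m)" "f \<in> borel_measurable M"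
  shows "E f [m] (\<lambda>x. H (x 0)) = (\<integral>\<^sup>+y. H y * ennreal (\<Prod>j<m. f (y j)) \<partial>nu m)"
proof -
  interpret product_sigma_finite "\<lambda>_::nat. nu m"
    by (rule product_sigma_finite_nu)
  show ?thesis
    unfolding E_def mu_single
    using product_nn_integral_singleton[of "\<lambda>y. H y * ennreal (\<Prod>j<m. f (y j))" 0]
    by (simp add: dens_def)
qed

text \<open>Tonelli's theorem splits off the last factor of the product measure, and the joint
  density is the product of the density of the past and that of the new group.\<close>

lemma E_snoc:
  assumes F: "F \<in> borel_measurable (mu (n @ [m]))"
  shows "E f0 (n @ [m]) F = E f0 n (\<lambda>x. E f0 [m] (\<lambda>y. F (x(length n := y 0))))"
proof -
  let ?k = "length n"
  interpret product_sigma_finite "\<lambda>i. nu ((n @ [m]) ! i)"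
    by (rule product_sigma_finite_nu)
  let ?D = "\<lambda>y. ennreal (\<Prod>j<m. f0 (y j))"
  have mu_n: "mu n = (\<Pi>\<^sub>M i\<in>{..<?k}. nu ((n @ [m]) ! i))"
    using mu_eq_PiM[of ?k "n @ [m]"] by simp
  note [measurable] = F
  have Fu[measurable]: "(\<lambda>y. F (x(?k := y))) \<in> borel_measurable (nu m)" if "x \<in> space (mu n)" for x
    using measurable_compose[OF measurable_Pair1'[OF that] measurable_compose[OF measurable_snoc F]]
    by simp
  have "E f0 (n @ [m]) F = (\<integral>\<^sup>+x. \<integral>\<^sup>+y. F (x(?k := y)) * ennreal (dens f0 (n @ [m]) (x(?k := y))) \<partial>nu m \<partial>mu n)"
    unfolding E_def mu_n
    using product_nn_integral_insert[of "{..<?k}" ?k "\<lambda>x. F x * ennreal (dens f0 (n @ [m]) x)"]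
    by (simp add: mu_snoc[symmetric])
  also have "\<dots> = (\<integral>\<^sup>+x. (\<integral>\<^sup>+y. F (x(?k := y)) * ?D y \<partial>nu m) * ennreal (dens f0 n x) \<partial>mu n)"
  proof (intro nn_integral_cong)
    fix x assume x: "x \<in> space (mu n)"
    have "dens f0 (n @ [m]) (x(?k := y)) = dens f0 n x * (\<Prod>j<m. f0 (y j))" for y
      using dens_snoc[of f0 n m x "\<lambda>_. y"] by (simp add: dens_def[of _ "[m]"])
    moreover have "0 \<le> (\<Prod>j<m. f0 (y j))" if "y \<in> space (nu m)" for y
      using that by (intro prod_nonneg) (auto simp: space_PiM PiE_iff intro: f0_nonneg)
    ultimately have "(\<integral>\<^sup>+y. F (x(?k := y)) * ennreal (dens f0 (n @ [m]) (x(?k := y))) \<partial>nu m) =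
        (\<integral>\<^sup>+y. (F (x(?k := y)) * ?D y) * ennreal (dens f0 n x) \<partial>nu m)"
      using x by (intro nn_integral_cong) (simp add: ennreal_mult mult_ac)
    also have "\<dots> = (\<integral>\<^sup>+y. F (x(?k := y)) * ?D y \<partial>nu m) * ennreal (dens f0 n x)"
      using x by (intro nn_integral_multc) measurable
    finally show "(\<integral>\<^sup>+y. F (x(?k := y)) * ennreal (dens f0 (n @ [m]) (x(?k := y))) \<partial>nu m) = \<dots>" .
  qed
  also have "\<dots> = E f0 n (\<lambda>x. E f0 [m] (\<lambda>y. F (x(length n := y 0))))"
    unfolding E_def[of _ n] by (intro nn_integral_cong) (subst E_single[OF Fu f0_measurable], auto)
  finally show ?thesis .
qed

lemma E_snoc_measurable:
  assumes F: "F \<in> borel_measurable (mu (n @ [m]))"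
  shows "(\<lambda>x. E f0 [m] (\<lambda>y. F (x(length n := y 0)))) \<in> borel_measurable (mu n)"
proof -
  interpret sigma_finite_measure "nu m" by (rule sigma_finite_nu)
  have Fu[measurable]: "(\<lambda>(x, y). F (x(length n := y))) \<in> borel_measurable (mu n \<Otimes>\<^sub>M nu m)"
    using measurable_compose[OF measurable_snoc F] by (simp add: case_prod_beta)
  have "(\<lambda>x. \<integral>\<^sup>+y. F (x(length n := y)) * ennreal (\<Prod>j<m. f0 (y j)) \<partial>nu m) \<in> borel_measurable (mu n)"
    by measurable
  moreover have "E f0 [m] (\<lambda>y. F (x(length n := y 0))) =
      (\<integral>\<^sup>+y. F (x(length n := y)) * ennreal (\<Prod>j<m. f0 (y j)) \<partial>nu m)" if "x \<in> space (mu n)" for x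
    using measurable_compose[OF measurable_Pair1'[OF that] Fu] by (intro E_single) auto
  ultimately show ?thesis by (simp cong: measurable_cong)
qed

lemma nn_integral_dens_single: "(\<integral>\<^sup>+x. ennreal (dens f0 [m] x) \<partial>mu [m]) = 1"
proof -
  interpret product_sigma_finite "\<lambda>_::nat. M"
    by unfold_locales
  have "(\<integral>\<^sup>+x. ennreal (dens f0 [m] x) \<partial>mu [m]) = (\<integral>\<^sup>+y. ennreal (\<Prod>j<m. f0 (y j)) \<partial>nu m)"
    using E_single[of "\<lambda>_. 1" m f0] by (simp add: E_def)
  also have "\<dots> = (\<integral>\<^sup>+y. (\<Prod>j<m. ennreal (f0 (y j))) \<partial>nu m)"
    by (intro nn_integral_cong prod_ennreal[symmetric]) (auto simp: space_PiM PiE_iff intro: f0_nonneg)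
  also have "\<dots> = (\<Prod>j<m. \<integral>\<^sup>+x. ennreal (f0 x) \<partial>M)"
    by (rule product_nn_integral_prod) auto
  finally show ?thesis by (simp add: f0_density)
qed

section \<open>Vectors of group sizes and sums over them\<close>

lemma countable_sizes [simp]: "countable (sizes k)"
  by (rule countableI_type)

lemma nn_integral_sizes_Suc:
  "(\<integral>\<^sup>+n. h n \<partial>count_space (sizes (Suc k))) =
   (\<integral>\<^sup>+n. \<integral>\<^sup>+m. h (n @ [m]) \<partial>count_space G \<partial>count_space (sizes k))"
proof -
  have "bij_betw (\<lambda>(n, m). n @ [m]) (sizes k \<times> G) (sizes (Suc k))"
    by (intro bij_betwI[where g = "\<lambda>n. (butlast n, last n)"])
      (force simp: sizes_def length_Suc_conv_rev dest: in_set_butlastD)+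
  from nn_integral_bij_count_space[OF this, of h] show ?thesis
    by (simp add: nn_integral_count_space_Times case_prod_beta)
qed

lemma snoc_in_sizes: "n \<in> sizes k \<Longrightarrow> m \<in> G \<Longrightarrow> n @ [m] \<in> sizes (Suc k)"
  by (simp add: sizes_def)

lemma length_sizes: "n \<in> sizes k \<Longrightarrow> length n = k"
  by (simp add: sizes_def)

lemma take_sizes: "n \<in> sizes k \<Longrightarrow> i \<le> k \<Longrightarrow> take i n \<in> sizes i"
  by (auto simp: sizes_def dest: in_set_takeD)

lemma prob_sizes_nonneg: "0 \<le> prob_sizes n"
  unfolding prob_sizes_def by (intro prod_nonneg) auto

lemma prob_sizes_snoc: "prob_sizes (n @ [m]) = prob_sizes n * pmf (p (Suc (length n))) m"
  by (simp add: prob_sizes_def nth_append)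

lemma c_nth_nonneg: "n \<in> sizes k \<Longrightarrow> i < k \<Longrightarrow> 0 \<le> c (n ! i)"
  using cost_pos[of "n ! i"] nth_mem[of i n, THEN subsetD[of "set n" G, rotated]]
  by (simp add: sizes_def)

lemma cost_nonneg: "n \<in> sizes k \<Longrightarrow> 0 \<le> cost n"
  unfolding cost_def by (intro sum_nonneg) (auto simp: length_sizes c_nth_nonneg)

lemma ennreal_cost_snoc:
  "n \<in> sizes k \<Longrightarrow> m \<in> G \<Longrightarrow> ennreal (cost (n @ [m])) = ennreal (cost n) + ennreal (c m)"
  using cost_nonneg[of n k] cost_pos[of m] by (simp add: cost_def nth_append flip: ennreal_plus)

lemma cost_take_le: "n \<in> sizes k \<Longrightarrow> i \<le> k \<Longrightarrow> cost (take i n) \<le> cost n"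
  unfolding cost_def by (auto simp: length_sizes c_nth_nonneg intro!: sum_mono2)

lemma mean_c_eq: "mean_c k = (\<integral>\<^sup>+m. ennreal (pmf (p k) m) * ennreal (c m) \<partial>count_space G)"
  unfolding mean_c_def
  by (subst infsum_ennreal_eq_nn_integral) (auto intro!: nn_integral_cong ennreal_mult')

lemma mean_c_finite: "k \<ge> 1 \<Longrightarrow> mean_c k < \<infinity>"
  using mean_cost[of k] by (simp add: mean_c_def)

lemma nn_integral_pmf_G: "k \<ge> 1 \<Longrightarrow> (\<integral>\<^sup>+m. ennreal (pmf (p k) m) \<partial>count_space G) = 1"
  using sizes_in_G[of k] by (auto simp: nn_integral_pmf AE_measure_pmf_iff intro!: measure_pmf.emeasure_eq_1_AE)

text \<open>No density is built in, because the type II error integrates against \<open>f1\<close>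
  and the minimal decision loss involves both densities. With the density of the null hypothesis,
  \<open>total0\<close> is the expectation at stage \<open>k\<close> over random sizes and
  data.\<close>

definition total :: "nat \<Rightarrow> (nat list \<Rightarrow> 'a data \<Rightarrow> ennreal) \<Rightarrow> ennreal" where
  "total k F = (\<integral>\<^sup>+n. ennreal (prob_sizes n) * (\<integral>\<^sup>+x. F n x \<partial>mu n) \<partial>count_space (sizes k))"

abbreviation total0 :: "nat \<Rightarrow> (nat list \<Rightarrow> 'a data \<Rightarrow> ennreal) \<Rightarrow> ennreal" where
  "total0 k F \<equiv> total k (\<lambda>n x. F n x * ennreal (dens f0 n x))"

definition adapted :: "nat \<Rightarrow> (nat list \<Rightarrow> 'a data \<Rightarrow> ennreal) \<Rightarrow> bool" where
  "adapted k F \<longleftrightarrow> (\<forall>n\<in>sizes k. F n \<in> borel_measurable (mu n))"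

lemma adaptedD: "adapted k F \<Longrightarrow> n \<in> sizes k \<Longrightarrow> F n \<in> borel_measurable (mu n)"
  by (simp add: adapted_def)

lemma infsum_E_eq_total0:
  "(\<Sum>\<^sub>\<infinity>n\<in>sizes k. ennreal (prob_sizes n) * E f0 n (F n)) = total0 k F"
  by (simp add: infsum_ennreal_eq_nn_integral total_def E_def)

lemma total_cong:
  assumes "\<And>n x. n \<in> sizes k \<Longrightarrow> x \<in> space (mu n) \<Longrightarrow> F n x = H n x"
  shows "total k F = total k H"
  unfolding total_def using assms by (auto intro!: nn_integral_cong arg_cong2[of _ _ _ _ times])

lemma total_mono:
  assumes "\<And>n x. n \<in> sizes k \<Longrightarrow> x \<in> space (mu n) \<Longrightarrow> F n x \<le> H n x"
  shows "total k F \<le> total k H"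
  unfolding total_def using assms by (auto intro!: nn_integral_mono mult_left_mono)

text \<open>Points where \<open>dens f0\<close> vanishes carry no weight. This makes the product
  formula for \<open>z\<close> usable, which is available only where \<open>dens f0\<close> is
  positive.\<close>

lemma total0_cong:
  assumes "\<And>n x. n \<in> sizes k \<Longrightarrow> x \<in> space (mu n) \<Longrightarrow> dens f0 n x > 0 \<Longrightarrow> F n x = H n x"
  shows "total0 k F = total0 k H"
proof (rule total_cong)
  fix n x assume "n \<in> sizes k" "x \<in> space (mu n)"
  then show "F n x * ennreal (dens f0 n x) = H n x * ennreal (dens f0 n x)"
    using assms[of n x] f0_dens_nonneg[of x n] by (cases "dens f0 n x = 0") (auto simp: less_le)
qed

lemma total0_mono:
  assumes "\<And>n x. n \<in> sizes k \<Longrightarrow> x \<in> space (mu n) \<Longrightarrow> F n x \<le> H n x"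
  shows "total0 k F \<le> total0 k H"
  using assms by (intro total_mono mult_right_mono) auto

lemma total_add:
  assumes "adapted k F" "adapted k H"
  shows "total k (\<lambda>n x. F n x + H n x) = total k F + total k H"
proof -
  have "(\<integral>\<^sup>+x. F n x + H n x \<partial>mu n) = (\<integral>\<^sup>+x. F n x \<partial>mu n) + (\<integral>\<^sup>+x. H n x \<partial>mu n)" if "n \<in> sizes k" for n
    using assms that by (intro nn_integral_add) (auto simp: adaptedD)
  then show ?thesis
    unfolding total_def
    by (subst nn_integral_add[symmetric]) (auto intro!: nn_integral_cong simp: distrib_left)
qed

lemma total_cmult:
  assumes "adapted k F"
  shows "total k (\<lambda>n x. a * F n x) = a * total k F"
proof -
  have "(\<integral>\<^sup>+x. a * F n x \<partial>mu n) = a * (\<integral>\<^sup>+x. F n x \<partial>mu n)" if "n \<in> sizes k" for n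
    using assms that by (intro nn_integral_cmult) (auto simp: adaptedD)
  then show ?thesis
    unfolding total_def
    by (subst nn_integral_cmult[symmetric]) (auto intro!: nn_integral_cong simp: mult_ac)
qed

lemma adapted_dens0: "adapted k F \<Longrightarrow> adapted k (\<lambda>n x. F n x * ennreal (dens f0 n x))"
  unfolding adapted_def by auto

lemma total0_add:
  assumes "adapted k F" "adapted k H"
  shows "total0 k (\<lambda>n x. F n x + H n x) = total0 k F + total0 k H"
  using total_add[OF assms[THEN adapted_dens0]] by (simp add: distrib_right)

lemma total0_cmult:
  assumes "adapted k F"
  shows "total0 k (\<lambda>n x. a * F n x) = a * total0 k F"
  using total_cmult[OF assms[THEN adapted_dens0]] by (simp add: mult.assoc)

text \<open>The equality argument runs on two levels: first over the size vectors, where a positive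
  \<open>prob_sizes n\<close> can be cancelled, then over the data for fixed \<open>n\<close>. The
  finite total bounds each integral so that the second level applies.\<close>

lemma total_eq_imp_AE_eq:
  assumes F: "adapted k F" and H: "adapted k H"
    and le: "\<And>n x. n \<in> sizes k \<Longrightarrow> x \<in> space (mu n) \<Longrightarrow> F n x \<le> H n x"
    and eq: "total k F = total k H" and fin: "total k F < \<infinity>"
    and n: "n \<in> pos_sizes k"
  shows "AE x in mu n. F n x = H n x"
proof -
  have n': "n \<in> sizes k" "prob_sizes n > 0"
    using n by (auto simp: pos_sizes_def)
  have "AE n in count_space (sizes k). ennreal (prob_sizes n) * (\<integral>\<^sup>+x. F n x \<partial>mu n) =
      ennreal (prob_sizes n) * (\<integral>\<^sup>+x. H n x \<partial>mu n)"
    using le eq fin unfolding total_def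
    by (intro nn_integral_eq_imp_AE_eq) (auto intro!: mult_left_mono nn_integral_mono)
  then have eq_n: "(\<integral>\<^sup>+x. F n x \<partial>mu n) = (\<integral>\<^sup>+x. H n x \<partial>mu n)"
    using n' by (auto simp: AE_count_space ennreal_mult_cancel_left)
  have "ennreal (prob_sizes n) * (\<integral>\<^sup>+x. F n x \<partial>mu n) \<le> total k F"
    unfolding total_def using n'(1) by (rule nn_integral_ge_point)
  with fin have "ennreal (prob_sizes n) * (\<integral>\<^sup>+x. F n x \<partial>mu n) < \<infinity>"
    by (rule le_less_trans[rotated])
  then have "(\<integral>\<^sup>+x. F n x \<partial>mu n) < \<infinity>"
    using n' by (auto simp: ennreal_mult_less_top)
  then show ?thesis
    using F H n' le eq_n by (intro nn_integral_eq_imp_AE_eq) (auto simp: adaptedD)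
qed

text \<open>The tower property: the expectation at stage \<open>k + 1\<close> is computed by first
  averaging over the size and the data of the last group, given the first \<open>k\<close>
  groups.\<close>

lemma total0_Suc:
  assumes F: "adapted (Suc k) F"
  shows "total0 (Suc k) F = total0 k (\<lambda>n x.
    \<integral>\<^sup>+m. ennreal (pmf (p (Suc k)) m) * E f0 [m] (\<lambda>y. F (n @ [m]) (x(k := y 0))) \<partial>count_space G)"
proof -
  let ?q = "\<lambda>m. ennreal (pmf (p (Suc k)) m)"
  have "total0 (Suc k) F = (\<integral>\<^sup>+n. \<integral>\<^sup>+m. ennreal (prob_sizes (n @ [m])) * E f0 (n @ [m]) (F (n @ [m]))
      \<partial>count_space G \<partial>count_space (sizes k))"
    unfolding total_def E_def by (rule nn_integral_sizes_Suc)
  also have "\<dots> = total0 k (\<lambda>n x. \<integral>\<^sup>+m. ?q m * E f0 [m] (\<lambda>y. F (n @ [m]) (x(k := y 0))) \<partial>count_space G)"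
    unfolding total_def
  proof (rule nn_integral_cong)
    fix n assume "n \<in> space (count_space (sizes k))"
    then have n: "n \<in> sizes k" and k: "length n = k" by (auto simp: length_sizes)
    let ?H = "\<lambda>m x. E f0 [m] (\<lambda>y. F (n @ [m]) (x(k := y 0)))"
    have Hm: "?H m \<in> borel_measurable (mu n)" if "m \<in> G" for m
      using E_snoc_measurable[OF adaptedD[OF F snoc_in_sizes[OF n that]]] k by simp
    have "(\<integral>\<^sup>+m. ennreal (prob_sizes (n @ [m])) * E f0 (n @ [m]) (F (n @ [m])) \<partial>count_space G) =
        (\<integral>\<^sup>+m. ennreal (prob_sizes n) * (?q m * E f0 n (?H m)) \<partial>count_space G)"
      using E_snoc[OF adaptedD[OF F snoc_in_sizes[OF n]]] k
      by (intro nn_integral_cong) (simp add: prob_sizes_snoc ennreal_mult prob_sizes_nonneg mult_ac)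
    also have "\<dots> = ennreal (prob_sizes n) * (\<integral>\<^sup>+m. ?q m * E f0 n (?H m) \<partial>count_space G)"
      by (rule nn_integral_cmult) simp
    also have "(\<integral>\<^sup>+m. ?q m * E f0 n (?H m) \<partial>count_space G) =
        (\<integral>\<^sup>+m. \<integral>\<^sup>+x. ?q m * (?H m x * ennreal (dens f0 n x)) \<partial>mu n \<partial>count_space G)"
      unfolding E_def[of f0 n] using Hm
      by (intro nn_integral_cong nn_integral_cmult[symmetric]) auto
    \<comment> \<open>The sum over the new size moves inside the integral over the past data, so
      that the inner expression is a conditional expectation given the past.\<close>
    also have "\<dots> = (\<integral>\<^sup>+x. \<integral>\<^sup>+m. ?q m * (?H m x * ennreal (dens f0 n x)) \<partial>count_space G \<partial>mu n)"
      using Hm by (intro nn_integral_count_space_nn_integral[symmetric]) auto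
    also have "\<dots> = (\<integral>\<^sup>+x. (\<integral>\<^sup>+m. ?q m * ?H m x \<partial>count_space G) * ennreal (dens f0 n x) \<partial>mu n)"
      by (intro nn_integral_cong) (simp add: nn_integral_multc[symmetric] mult.assoc)
    finally show "(\<integral>\<^sup>+m. ennreal (prob_sizes (n @ [m])) * E f0 (n @ [m]) (F (n @ [m])) \<partial>count_space G) =
      ennreal (prob_sizes n) * (\<integral>\<^sup>+x. (\<integral>\<^sup>+m. ?q m * ?H m x \<partial>count_space G) * ennreal (dens f0 n x) \<partial>mu n)" .
  qed
  finally show ?thesis .
qed

subsection \<open>Value functions\<close>

text \<open>The one-step transition operator of the likelihood ratio under the null hypothesis:
  starting from \<open>y\<close>, group \<open>k\<close> of random size multiplies it by an
  independent factor.\<close>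

definition avg :: "nat \<Rightarrow> (ennreal \<Rightarrow> ennreal) \<Rightarrow> ennreal \<Rightarrow> ennreal" where
  "avg k f y = (\<integral>\<^sup>+m. ennreal (pmf (p k) m) * E f0 [m] (\<lambda>x. f (y * z [m] x)) \<partial>count_space G)"

lemma avg_mono: "(\<And>u. f u \<le> h u) \<Longrightarrow> avg k f y \<le> avg k h y"
  unfolding avg_def E_def by (intro nn_integral_mono mult_left_mono mult_right_mono) auto

lemma avg_const: "k \<ge> 1 \<Longrightarrow> avg k (\<lambda>_. a) y = a"
  by (simp add: avg_def E_def nn_integral_cmult nn_integral_multc nn_integral_dens_single nn_integral_pmf_G)

lemma avg_measurable [measurable]:
  assumes [measurable]: "f \<in> borel_measurable borel"
  shows "avg k f \<in> borel_measurable borel"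
proof -
  have [measurable]: "(\<lambda>y. E f0 [m] (\<lambda>x. f (y * z [m] x))) \<in> borel_measurable borel" for m
  proof -
    interpret product_sigma_finite "\<lambda>_::nat. nu m"
      by (rule product_sigma_finite_nu)
    interpret sigma_finite_measure "mu [m]"
      unfolding mu_single by (rule sigma_finite) simp
    show ?thesis unfolding E_def by measurable
  qed
  show ?thesis
    unfolding avg_def nn_integral_count_space_eq_indicator[where X = G] nn_integral_count_space_nat
    by measurable
qed

text \<open>Iterated integrals against measures are the form needed for the convergence theorem
  below. Sizes outside \<open>G\<close> have mass 0 and may be included.\<close>

lemma avg_pmf:
  assumes k: "k \<ge> 1" and [measurable]: "f \<in> borel_measurable borel"
  shows "avg k f y =
    (\<integral>\<^sup>+m. \<integral>\<^sup>+x. f (y * z [m] x) \<partial>density (mu [m]) (dens f0 [m]) \<partial>measure_pmf (p k))"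
proof -
  have "E f0 [m] (\<lambda>x. f (y * z [m] x)) = (\<integral>\<^sup>+x. f (y * z [m] x) \<partial>density (mu [m]) (dens f0 [m]))" for m
    by (simp add: E_def nn_integral_density mult.commute)
  moreover have "pmf (p k) m = 0" if "m \<notin> G" for m
    using sizes_in_G[OF k] that by (auto simp: set_pmf_iff)
  ultimately show ?thesis
    unfolding avg_def nn_integral_measure_pmf
    by simp (intro nn_integral_count_space_eq, auto)
qed

text \<open>Monotone convergence for decreasing sequences, used first for the data and then for the
  group size. The constant bound on \<open>f 0\<close> supplies the finite integrals that it
  requires.\<close>

lemma avg_INF:
  fixes f :: "nat \<Rightarrow> ennreal \<Rightarrow> ennreal"
  assumes k: "k \<ge> 1" and dec: "decseq f" and [measurable]: "\<And>i. f i \<in> borel_measurable borel"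
    and bound: "\<And>u. f 0 u \<le> a" and a: "a < \<infinity>"
  shows "avg k (\<lambda>u. INF i. f i u) y = (INF i. avg k (f i) y)"
proof -
  have dec': "f j u \<le> f i u" if "i \<le> j" for i j u
    using dec that by (auto dest: antimonoD le_funD)
  have *: "(\<integral>\<^sup>+x. (INF i. f i (y * z [m] x)) \<partial>P m) = (INF i. \<integral>\<^sup>+x. f i (y * z [m] x) \<partial>P m)"
    if P: "P = (\<lambda>m. density (mu [m]) (dens f0 [m]))" for m P
  proof -
    have "(\<integral>\<^sup>+x. f 0 (y * z [m] x) \<partial>P m) \<le> (\<integral>\<^sup>+x. a \<partial>P m)"
      by (intro nn_integral_mono bound)
    also have "\<dots> = a"
      unfolding P by (subst nn_integral_density) (auto simp: nn_integral_multc nn_integral_dens_single)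
    finally have "(\<integral>\<^sup>+x. f 0 (y * z [m] x) \<partial>P m) < \<infinity>"
      using a by (rule le_less_trans)
    then show ?thesis
      unfolding P
      by (intro nn_integral_monotone_convergence_INF_decseq[where i = 0])
        (auto intro!: antimonoI le_funI dec')
  qed
  have fin: "avg k (f 0) y < \<infinity>"
    using avg_mono[of "f 0" "\<lambda>_. a" k y] bound a by (simp add: avg_const[OF k] order.strict_trans1)
  have "avg k (\<lambda>u. INF i. f i u) y =
     (\<integral>\<^sup>+m. (INF i. \<integral>\<^sup>+x. f i (y * z [m] x) \<partial>density (mu [m]) (dens f0 [m])) \<partial>measure_pmf (p k))"
    by (subst *[OF refl, symmetric]) (simp add: avg_pmf[OF k])
  also have "\<dots> = (INF i. \<integral>\<^sup>+m. \<integral>\<^sup>+x. f i (y * z [m] x) \<partial>density (mu [m]) (dens f0 [m]) \<partial>measure_pmf (p k))"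
    using fin
    by (intro nn_integral_monotone_convergence_INF_decseq[where i = 0])
      (auto simp: avg_pmf[OF k] intro!: antimonoI le_funI nn_integral_mono dec')
  also have "\<dots> = (INF i. avg k (f i) y)"
    by (simp add: avg_pmf[OF k])
  finally show ?thesis .
qed

text \<open>Taking out what is known: the factor \<open>u\<close> depends only on the first
  \<open>k\<close> groups, so it leaves the average over the last one.\<close>

lemma total0_Suc_mult:
  assumes u: "adapted k u" and W: "adapted (Suc k) W"
  shows "total0 (Suc k) (\<lambda>n x. u (take k n) (restrict x {..<k}) * W n x) =
    total0 k (\<lambda>n x. u n x *
      (\<integral>\<^sup>+m. ennreal (pmf (p (Suc k)) m) * E f0 [m] (\<lambda>y. W (n @ [m]) (x(k := y 0))) \<partial>count_space G))"
proof -
  have "adapted (Suc k) (\<lambda>n x. u (take k n) (restrict x {..<k}) * W n x)"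
    unfolding adapted_def
  proof
    fix n assume n: "n \<in> sizes (Suc k)"
    then have [measurable]: "(\<lambda>x. restrict x {..<k}) \<in> mu n \<rightarrow>\<^sub>M mu (take k n)"
      by (intro measurable_restrict_mu) (simp add: length_sizes)
    have [measurable]: "u (take k n) \<in> borel_measurable (mu (take k n))" "W n \<in> borel_measurable (mu n)"
      using u W n by (auto simp: take_sizes intro: adaptedD)
    show "(\<lambda>x. u (take k n) (restrict x {..<k}) * W n x) \<in> borel_measurable (mu n)"
      by measurable
  qed
  from total0_Suc[OF this] show ?thesis
  proof (rule trans, intro total_cong arg_cong2[where f = "(*)"] refl)
    fix n x assume n: "n \<in> sizes k" and x: "x \<in> space (mu n)"
    have k: "length n = k" using n by (rule length_sizes)
    \<comment> \<open>Points of the data space are undefined outside their index set, so forgetting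
      the new group gives back \<open>x\<close> itself.\<close>
    have x': "restrict (x(k := v)) {..<k} = x" for v
      using x k by (auto simp: space_mu PiE_iff extensional_def restrict_def)
    let ?h = "\<lambda>m. E f0 [m] (\<lambda>y. W (n @ [m]) (x(k := y 0)))"
    have "E f0 [m] (\<lambda>y. u n x * W (n @ [m]) (x(k := y 0))) = u n x * ?h m" if "m \<in> G" for m
    proof -
      have W': "W (n @ [m]) \<in> borel_measurable (mu (n @ [m]))"
        using W that n by (auto intro: adaptedD snoc_in_sizes)
      have "(\<lambda>y. x(length n := y 0)) \<in> mu [m] \<rightarrow>\<^sub>M mu (n @ [m])"
        using measurable_compose[OF _ measurable_compose[OF measurable_Pair1'[OF x] measurable_snoc[of n m]],
            of "\<lambda>y. y 0" "mu [m]"] measurable_component_singleton[of 0 "{0}" "\<lambda>_. nu m"]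
        unfolding mu_single by simp
      then have [measurable]: "(\<lambda>y. W (n @ [m]) (x(k := y 0))) \<in> borel_measurable (mu [m])"
        using W' k by (auto intro: measurable_compose)
      show ?thesis
        unfolding E_def by (subst nn_integral_cmult[symmetric]) (auto simp: mult.assoc)
    qed
    then show "(\<integral>\<^sup>+m. ennreal (pmf (p (Suc k)) m) * E f0 [m] (\<lambda>y. u (take k (n @ [m]))
          (restrict (x(k := y 0)) {..<k}) * W (n @ [m]) (x(k := y 0))) \<partial>count_space G) =
        u n x * (\<integral>\<^sup>+m. ennreal (pmf (p (Suc k)) m) * ?h m \<partial>count_space G)"
      using k unfolding x'
      by (subst nn_integral_cmult[symmetric]) (auto intro!: nn_integral_cong simp: mult_ac)
  qed
qed

lemma E_single_const: "E f0 [m] (\<lambda>_. a) = a"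
  by (simp add: E_def nn_integral_cmult nn_integral_dens_single)

lemma total0_Suc_prefix:
  assumes "adapted k u"
  shows "total0 (Suc k) (\<lambda>n x. u (take k n) (restrict x {..<k})) = total0 k u"
  using total0_Suc_mult[OF assms, of "\<lambda>_ _. 1"]
  by (simp add: E_single_const nn_integral_pmf_G adapted_def)

text \<open>Stage 0 has only the empty vector and a one-point data space. It lets the one-step
  formulas treat the first group like any other.\<close>

lemma total0_0_const: "total0 0 (\<lambda>_ _. a) = a"
proof -
  have "sizes 0 = {[]}" by (auto simp: sizes_def)
  then show ?thesis
    by (simp add: total_def nn_integral_count_space_finite prob_sizes_def mu_def dens_def
        PiM_empty nn_integral_count_space_finite)
qed

text \<open>Positivity of both null densities makes all three ratios finite quotients, which
  excludes products of 0 and infinity.\<close>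

lemma z_snoc:
  assumes x: "x \<in> space (mu n)" "dens f0 n x > 0" and y: "y \<in> space (mu [m])" "dens f0 [m] y > 0"
  shows "z (n @ [m]) (x(length n := y 0)) = z n x * z [m] y"
proof -
  have "0 < dens f0 n x * dens f0 [m] y"
    using assms by simp
  moreover have "0 \<le> dens f1 n x / dens f0 n x" "0 \<le> dens f1 [m] y / dens f0 [m] y"
    using x(1) y(1) by auto
  ultimately show ?thesis
    unfolding z_def dens_snoc using assms by (simp flip: ennreal_mult)
qed

text \<open>Costs add and likelihood ratios multiply when a group is appended. Averaging over that
  group therefore yields its mean cost and the transition operator applied to \<open>f\<close>. This
  is the dynamic programming step.\<close>

lemma total0_Suc_cost:
  assumes u: "adapted k u" and f [measurable]: "f \<in> borel_measurable borel"
  shows "total0 (Suc k) (\<lambda>n x. u (take k n) (restrict x {..<k}) * (ennreal (cost n) + f (z n x))) =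
    total0 k (\<lambda>n x. u n x * (ennreal (cost n) + (mean_c (Suc k) + avg (Suc k) f (z n x))))"
proof -
  have W: "adapted (Suc k) (\<lambda>n x. ennreal (cost n) + f (z n x))"
    by (simp add: adapted_def)
  show ?thesis
  proof (rule trans[OF total0_Suc_mult[OF u W]], intro total0_cong arg_cong2[where f = "(*)"] refl)
    fix n x assume n: "n \<in> sizes k" and x: "x \<in> space (mu n)" "0 < dens f0 n x"
    have k: "length n = k" using n by (rule length_sizes)
    let ?q = "\<lambda>m. ennreal (pmf (p (Suc k)) m)"
    let ?h = "\<lambda>m. E f0 [m] (\<lambda>y. f (z n x * z [m] y))"
    have "E f0 [m] (\<lambda>y. ennreal (cost (n @ [m])) + f (z (n @ [m]) (x(k := y 0)))) =
        ennreal (cost n) + ennreal (c m) + ?h m" if "m \<in> G" for m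
    proof -
      have "E f0 [m] (\<lambda>y. ennreal (cost (n @ [m])) + f (z (n @ [m]) (x(k := y 0)))) =
          E f0 [m] (\<lambda>y. (ennreal (cost n) + ennreal (c m)) + f (z n x * z [m] y))"
        unfolding E_def
      proof (rule nn_integral_cong)
        \<comment> \<open>Where the density of the new group is 0 both sides vanish; elsewhere
          \<open>z\<close> factorises.\<close>
        fix y assume y: "y \<in> space (mu [m])"
        show "(ennreal (cost (n @ [m])) + f (z (n @ [m]) (x(k := y 0)))) * ennreal (dens f0 [m] y) =
            (ennreal (cost n) + ennreal (c m) + f (z n x * z [m] y)) * ennreal (dens f0 [m] y)"
          using z_snoc[OF x y] f0_dens_nonneg[OF y] k ennreal_cost_snoc[OF n that]
          by (cases "dens f0 [m] y = 0") (auto simp: less_le)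
      qed
      also have "\<dots> = ennreal (cost n) + ennreal (c m) + ?h m"
        unfolding E_def
        by (simp add: distrib_right nn_integral_add nn_integral_cmult nn_integral_dens_single)
      finally show ?thesis .
    qed
    then have "(\<integral>\<^sup>+m. ?q m * E f0 [m] (\<lambda>y. ennreal (cost (n @ [m])) + f (z (n @ [m]) (x(k := y 0)))) \<partial>count_space G) =
        (\<integral>\<^sup>+m. ennreal (cost n) * ?q m + (?q m * ennreal (c m) + ?q m * ?h m) \<partial>count_space G)"
      by (intro nn_integral_cong) (simp add: distrib_left mult.commute add.assoc)
    also have "\<dots> = ennreal (cost n) + (mean_c (Suc k) + avg (Suc k) f (z n x))"
      by (simp add: nn_integral_add nn_integral_cmult nn_integral_pmf_G mean_c_eq avg_def)
    finally show "(\<integral>\<^sup>+m. ?q m * E f0 [m] (\<lambda>y. ennreal (cost (n @ [m])) + f (z (n @ [m]) (x(k := y 0)))) \<partial>count_space G) = \<dots>" .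
  qed
qed

section \<open>Truncated value functions and their limits\<close>

lemma g_measurable [measurable]: "g l0 l1 \<in> borel_measurable borel"
  unfolding g_def by measurable

lemma g_le: "g l0 l1 y \<le> ennreal l0"
  by (simp add: g_def)

lemma Vbar_trunc_eq: "Vbar_trunc l0 l1 N k y = avg k (V l0 l1 N k) y"
  unfolding Vbar_trunc_def avg_def by (simp add: infsum_ennreal_eq_nn_integral)

lemma V_base: "N \<le> k \<Longrightarrow> V l0 l1 N k = g l0 l1"
  by (intro ext) (simp add: V.simps)

lemma V_rec: "k < N \<Longrightarrow>
    V l0 l1 N k = (\<lambda>y. min (g l0 l1 y) (mean_c (Suc k) + avg (Suc k) (V l0 l1 N (Suc k)) y))"
  by (intro ext, subst V.simps) (simp add: avg_def infsum_ennreal_eq_nn_integral)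

lemma V_measurable [measurable]: "V l0 l1 N k \<in> borel_measurable borel"
proof (induction "N - k" arbitrary: k)
  case 0
  then show ?case by (simp add: V_base)
next
  case (Suc d)
  then have [measurable]: "V l0 l1 N (Suc k) \<in> borel_measurable borel" by simp
  show ?case using Suc by (simp add: V_rec)
qed

lemma V_le_g: "V l0 l1 N k y \<le> g l0 l1 y"
  by (cases "N \<le> k") (simp_all add: V_base V_rec)

text \<open>A longer horizon offers more choices. At \<open>k \<ge> N\<close> the shorter problem
  must stop and pays \<open>g\<close>, which bounds every value function; the backward recursion is
  monotone and preserves the inequality.\<close>

lemma V_Suc_le: "V l0 l1 (Suc N) k y \<le> V l0 l1 N k y"
proof (induction "N - k" arbitrary: k y)
  case 0
  then show ?case by (simp add: V_base V_le_g)
next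
  case (Suc d)
  then have "avg (Suc k) (V l0 l1 (Suc N) (Suc k)) y \<le> avg (Suc k) (V l0 l1 N (Suc k)) y"
    by (intro avg_mono) auto
  then have "mean_c (Suc k) + avg (Suc k) (V l0 l1 (Suc N) (Suc k)) y \<le>
      mean_c (Suc k) + avg (Suc k) (V l0 l1 N (Suc k)) y"
    by (rule add_left_mono)
  then show ?case using Suc(2) by (simp add: V_rec min_le_iff_disj)
qed

text \<open>The limit over horizons. Writing it as an infimum, equivalent by monotonicity, gives
  measurability directly and fits the exchange with \<open>avg\<close>.\<close>

definition Vlim :: "real \<Rightarrow> real \<Rightarrow> nat \<Rightarrow> ennreal \<Rightarrow> ennreal" where
  "Vlim l0 l1 k y = (INF N. V l0 l1 N k y)"

lemma V_tendsto: "(\<lambda>N. V l0 l1 N k y) \<longlonglongrightarrow> Vlim l0 l1 k y"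
  unfolding Vlim_def by (intro LIMSEQ_INF decseq_SucI V_Suc_le)

lemma Vlim_measurable [measurable]: "Vlim l0 l1 k \<in> borel_measurable borel"
  unfolding Vlim_def by measurable

lemma Vbar_trunc_tendsto:
  assumes "k \<ge> 1"
  shows "(\<lambda>N. Vbar_trunc l0 l1 N k y) \<longlonglongrightarrow> avg k (Vlim l0 l1 k) y"
proof -
  have "decseq (\<lambda>N. V l0 l1 N k)"
    by (intro decseq_SucI le_funI V_Suc_le)
  moreover have "V l0 l1 0 k u \<le> ennreal l0" for u
    using V_le_g g_le by (rule order.trans)
  ultimately have "avg k (Vlim l0 l1 k) y = (INF N. avg k (V l0 l1 N k) y)"
    unfolding Vlim_def using assms by (intro avg_INF) auto
  then show ?thesis
    unfolding Vbar_trunc_eq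
    by (auto intro!: LIMSEQ_INF decseq_SucI avg_mono V_Suc_le)
qed

lemma Vbar_eq: "k \<ge> 1 \<Longrightarrow> Vbar l0 l1 k y = avg k (Vlim l0 l1 k) y"
  unfolding Vbar_def by (intro limI Vbar_trunc_tendsto)

lemma Vbar_measurable [measurable]: "k \<ge> 1 \<Longrightarrow> Vbar l0 l1 k \<in> borel_measurable borel"
  using avg_measurable[OF Vlim_measurable] Vbar_eq[of k l0 l1] by (simp cong: measurable_cong)

text \<open>The Bellman equation without horizon: for \<open>N > k\<close> the truncated recursion
  holds, and both sides converge as \<open>N\<close> grows.\<close>

lemma Vlim_eq: "Vlim l0 l1 k y = min (g l0 l1 y) (mean_c (Suc k) + Vbar l0 l1 (Suc k) y)"
proof (rule LIMSEQ_unique[OF V_tendsto])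
  have "(\<lambda>N. min (g l0 l1 y) (mean_c (Suc k) + Vbar_trunc l0 l1 N (Suc k) y))
      \<longlonglongrightarrow> min (g l0 l1 y) (mean_c (Suc k) + Vbar l0 l1 (Suc k) y)"
    using Vbar_trunc_tendsto[of "Suc k" l0 l1 y]
    by (intro tendsto_min tendsto_add tendsto_const) (simp_all add: Vbar_eq)
  moreover have "eventually (\<lambda>N. min (g l0 l1 y) (mean_c (Suc k) + Vbar_trunc l0 l1 N (Suc k) y) = V l0 l1 N k y) sequentially"
    using eventually_gt_at_top[of k] by eventually_elim (simp add: V_rec Vbar_trunc_eq)
  ultimately show "(\<lambda>N. V l0 l1 N k y) \<longlonglongrightarrow> min (g l0 l1 y) (mean_c (Suc k) + Vbar l0 l1 (Suc k) y)"
    by (rule Lim_transform_eventually)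
qed

lemma Vlim_le: "Vlim l0 l1 k y \<le> ennreal l0"
  unfolding Vlim_eq using g_le by (simp add: min.coboundedI1)

section \<open>Further comparison rules for totals\<close>

lemma adaptedI: "(\<And>n. n \<in> sizes k \<Longrightarrow> F n \<in> borel_measurable (mu n)) \<Longrightarrow> adapted k F"
  by (simp add: adapted_def)

lemma total_cong_AE:
  assumes "\<And>n. n \<in> pos_sizes k \<Longrightarrow> AE x in mu n. F n x = H n x"
  shows "total k F = total k H"
  unfolding total_def
proof (rule nn_integral_cong)
  fix n assume "n \<in> space (count_space (sizes k))"
  then have "prob_sizes n = 0 \<or> n \<in> pos_sizes k"
    using prob_sizes_nonneg[of n] by (auto simp: pos_sizes_def less_le)
  then show "ennreal (prob_sizes n) * (\<integral>\<^sup>+x. F n x \<partial>mu n) = ennreal (prob_sizes n) * (\<integral>\<^sup>+x. H n x \<partial>mu n)"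
  proof
    assume "n \<in> pos_sizes k"
    then show ?thesis using nn_integral_cong_AE[OF assms] by simp
  qed simp
qed

text \<open>A sum of nonnegative terms is the supremum of its finite partial sums. Restricting to
  finitely many size vectors later makes the costs bounded.\<close>

lemma total_le_finite:
  assumes "\<And>A. finite A \<Longrightarrow> A \<subseteq> sizes k \<Longrightarrow> total k (\<lambda>n x. indicator A n * F n x) \<le> X"
  shows "total k F \<le> X"
proof -
  let ?a = "\<lambda>n. ennreal (prob_sizes n) * (\<integral>\<^sup>+x. F n x \<partial>mu n)"
  have "total k F = infsum ?a (sizes k)"
    by (simp add: total_def infsum_ennreal_eq_nn_integral)
  also have "\<dots> \<le> X"
  proof (rule infsum_le_finite_sums)
    fix A assume A: "finite A" "A \<subseteq> sizes k"
    have "sum ?a A = (\<integral>\<^sup>+n. ?a n * indicator A n \<partial>count_space (sizes k))"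
      using A by (subst nn_integral_count_space'[of A]) auto
    also have "\<dots> = total k (\<lambda>n x. indicator A n * F n x)"
      unfolding total_def by (intro nn_integral_cong) (simp split: split_indicator)
    finally show "sum ?a A \<le> X" using assms[OF A] by simp
  qed (rule nonneg_summable_on_complete, simp)
  finally show ?thesis .
qed

subsection \<open>Stopping rules\<close>

lemma rule_bounds:
  assumes "is_rule \<psi>" "n \<in> sizes k" "k \<ge> 1" "x \<in> space (mu n)"
  shows "0 \<le> \<psi> n x" "\<psi> n x \<le> 1"
  using assms by (auto simp: is_rule_def)

lemma rule_measurable: "is_rule \<psi> \<Longrightarrow> n \<in> sizes k \<Longrightarrow> k \<ge> 1 \<Longrightarrow> \<psi> n \<in> borel_measurable (mu n)"
  by (auto simp: is_rule_def)

lemma t_bounds: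
  assumes "is_rule \<psi>" "n \<in> sizes k" "x \<in> space (mu n)"
  shows "0 \<le> t \<psi> n x" "t \<psi> n x \<le> 1"
proof -
  have "0 \<le> \<psi> (take i n) (restrict x {..<i}) \<and> \<psi> (take i n) (restrict x {..<i}) \<le> 1"
    if "i \<in> {1..<length n}" for i
    using assms that measurable_space[OF measurable_restrict_mu[of i n] assms(3)]
    by (auto intro!: rule_bounds[of _ _ i] take_sizes simp: length_sizes)
  then show "0 \<le> t \<psi> n x" "t \<psi> n x \<le> 1"
    unfolding t_def by (auto intro!: prod_nonneg prod_le_1)
qed

lemma t_measurable:
  assumes "is_rule \<psi>" "n \<in> sizes k"
  shows "t \<psi> n \<in> borel_measurable (mu n)"
proof -
  have [measurable]: "(\<lambda>x. \<psi> (take i n) (restrict x {..<i})) \<in> borel_measurable (mu n)"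
    if "i \<in> {1..<length n}" for i
    using assms that
    by (intro measurable_compose[OF measurable_restrict_mu[of i n] rule_measurable[of _ _ i]])
      (auto intro: take_sizes simp: length_sizes)
  show ?thesis unfolding t_def by measurable
qed

text \<open>The product in \<open>t\<close> starts at index 1, so a factor is gained only for
  \<open>k \<ge> 1\<close>; with a single group no stopping decision has been passed yet.\<close>

lemma t_Suc:
  assumes "n \<in> sizes (Suc k)" "k \<ge> 1"
  shows "t \<psi> n x = t \<psi> (take k n) (restrict x {..<k}) * (1 - \<psi> (take k n) (restrict x {..<k}))"
proof -
  have "{1..<Suc k} = insert k {1..<k}" using assms by auto
  then show ?thesis
    using assms(1) by (simp add: t_def length_sizes mult.commute min_def restrict_restrict Int_absorb1 lessThan_subset_iff)
qed

lemma t_single: "n \<in> sizes (Suc 0) \<Longrightarrow> t \<psi> n x = 1"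
  by (simp add: t_def length_sizes)

lemma s_nonneg: "is_rule \<psi> \<Longrightarrow> n \<in> sizes k \<Longrightarrow> k \<ge> 1 \<Longrightarrow> x \<in> space (mu n) \<Longrightarrow> 0 \<le> s \<psi> n x"
  unfolding s_def using t_bounds rule_bounds by (auto intro!: mult_nonneg_nonneg)

lemma s_measurable:
  "is_rule \<psi> \<Longrightarrow> n \<in> sizes k \<Longrightarrow> k \<ge> 1 \<Longrightarrow> s \<psi> n \<in> borel_measurable (mu n)"
  unfolding s_def using t_measurable rule_measurable by (auto intro!: borel_measurable_times)

lemma t_split:
  assumes "is_rule \<psi>" "n \<in> sizes k" "k \<ge> 1" "x \<in> space (mu n)"
  shows "ennreal (t \<psi> n x) = ennreal (s \<psi> n x) + ennreal (t \<psi> n x * (1 - \<psi> n x))"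
  using t_bounds[OF assms(1,2,4)] rule_bounds[OF assms]
  by (subst ennreal_plus[symmetric]) (auto simp: s_def algebra_simps intro!: mult_left_le_one_le)

section \<open>Mean cost, error probabilities and survival as series over stages\<close>

lemma K0_eq:
  assumes "is_rule \<psi>"
  shows "K0 \<psi> = (\<Sum>k. total0 (Suc k) (\<lambda>n x. ennreal (s \<psi> n x) * ennreal (cost n)))"
proof -
  have "ennreal (prob_sizes n * cost n) * E f0 n (\<lambda>x. ennreal (s \<psi> n x)) =
      ennreal (prob_sizes n) * E f0 n (\<lambda>x. ennreal (s \<psi> n x) * ennreal (cost n))"
    if n: "n \<in> sizes (Suc k)" for n k
  proof -
    note [measurable] = s_measurable[OF assms n]
    have "E f0 n (\<lambda>x. ennreal (s \<psi> n x) * ennreal (cost n)) =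
        (\<integral>\<^sup>+x. ennreal (cost n) * (ennreal (s \<psi> n x) * ennreal (dens f0 n x)) \<partial>mu n)"
      unfolding E_def by (intro nn_integral_cong) (simp add: mult_ac)
    also have "\<dots> = ennreal (cost n) * E f0 n (\<lambda>x. ennreal (s \<psi> n x))"
      unfolding E_def by (intro nn_integral_cmult) auto
    finally show ?thesis
      by (simp add: ennreal_mult prob_sizes_nonneg cost_nonneg[OF n] mult_ac)
  qed
  then show ?thesis
    unfolding K0_def infsum_atLeast_1 infsum_E_eq_total0[symmetric]
    by (intro suminf_cong infsum_cong)
qed

lemma \<alpha>_eq: "\<alpha> \<psi> \<phi> = (\<Sum>k. total0 (Suc k) (\<lambda>n x. ennreal (s \<psi> n x * \<phi> n x)))"
  unfolding \<alpha>_def infsum_atLeast_1 infsum_E_eq_total0 ..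

lemma \<beta>_eq: "\<beta> \<psi> \<phi> =
    (\<Sum>k. total (Suc k) (\<lambda>n x. ennreal (s \<psi> n x * (1 - \<phi> n x)) * ennreal (dens f1 n x)))"
  unfolding \<beta>_def infsum_atLeast_1
  by (simp add: infsum_ennreal_eq_nn_integral total_def E_def)

lemma stopping_rules0_iff:
  "\<psi> \<in> stopping_rules0 \<longleftrightarrow> is_rule \<psi> \<and> (\<Sum>k. total0 (Suc k) (\<lambda>n x. ennreal (s \<psi> n x))) = 1"
  unfolding stopping_rules0_def infsum_atLeast_1 infsum_E_eq_total0 by simp

text \<open>A path that reaches stage \<open>k\<close> either stops there or reaches the next stage.
  The weight \<open>w\<close> sees only the first \<open>i \<le> k\<close> sizes, so it is unchanged
  by a further group, whose total mass is 1.\<close>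

lemma total0_stop_split:
  assumes \<psi>: "is_rule \<psi>" and k: "k \<ge> 1" "i \<le> k"
  shows "total0 k (\<lambda>n x. ennreal (t \<psi> n x) * w (take i n)) =
    total0 k (\<lambda>n x. ennreal (s \<psi> n x) * w (take i n)) +
    total0 (Suc k) (\<lambda>n x. ennreal (t \<psi> n x) * w (take i n))"
proof -
  let ?u = "\<lambda>n x. ennreal (t \<psi> n x * (1 - \<psi> n x)) * w (take i n)"
  note m = t_measurable[OF \<psi>] s_measurable[OF \<psi>] rule_measurable[OF \<psi>]
  have u: "adapted k ?u"
    using m k by (intro adaptedI) auto
  have "total0 (Suc k) (\<lambda>n x. ennreal (t \<psi> n x) * w (take i n)) =
      total0 (Suc k) (\<lambda>n x. ?u (take k n) (restrict x {..<k}))"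
    using k by (intro total_cong) (simp add: t_Suc min_def)
  also have "\<dots> = total0 k ?u"
    by (rule total0_Suc_prefix[OF u])
  finally have "total0 k (\<lambda>n x. ennreal (s \<psi> n x) * w (take i n)) +
      total0 (Suc k) (\<lambda>n x. ennreal (t \<psi> n x) * w (take i n)) =
      total0 k (\<lambda>n x. ennreal (s \<psi> n x) * w (take i n) + ?u n x)"
    using m k u by (subst total0_add) (auto intro!: adaptedI)
  also have "\<dots> = total0 k (\<lambda>n x. ennreal (t \<psi> n x) * w (take i n))"
    using \<psi> k by (intro total_cong) (simp add: t_split distrib_right)
  finally show ?thesis ..
qed

lemma total0_stop_sum:
  assumes \<psi>: "is_rule \<psi>" and k: "k \<ge> 1" "i \<le> k"
  shows "(\<Sum>j<d. total0 (k + j) (\<lambda>n x. ennreal (s \<psi> n x) * w (take i n))) +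
    total0 (k + d) (\<lambda>n x. ennreal (t \<psi> n x) * w (take i n)) =
    total0 k (\<lambda>n x. ennreal (t \<psi> n x) * w (take i n))"
proof (induction d)
  case (Suc d)
  with total0_stop_split[OF \<psi>, of "k + d" i w] k show ?case
    by (simp add: add.assoc)
qed simp

lemma total0_t_single: "total0 (Suc 0) (\<lambda>n x. ennreal (t \<psi> n x)) = 1"
proof -
  have "total0 (Suc 0) (\<lambda>n x. ennreal (t \<psi> n x)) = total0 (Suc 0) (\<lambda>n x. 1)"
    by (intro total_cong) (simp add: t_single)
  also have "\<dots> = 1"
    using total0_Suc_prefix[of 0 "\<lambda>_ _. 1"] total0_0_const[of 1] by (simp add: adapted_def)
  finally show ?thesis .
qed

text \<open>The probability of reaching a stage is 1 minus the probability of having stopped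
  earlier, and the latter tends to 1 for rules in \<open>stopping_rules0\<close>.\<close>

lemma total0_t_tendsto_0:
  assumes "\<psi> \<in> stopping_rules0"
  shows "(\<lambda>k. total0 k (\<lambda>n x. ennreal (t \<psi> n x))) \<longlonglongrightarrow> 0"
proof -
  have \<psi>: "is_rule \<psi>" and sum: "(\<Sum>k. total0 (Suc k) (\<lambda>n x. ennreal (s \<psi> n x))) = 1"
    using assms by (auto simp: stopping_rules0_iff)
  let ?S = "\<lambda>d. \<Sum>j<d. total0 (Suc j) (\<lambda>n x. ennreal (s \<psi> n x))"
  have eq: "?S d + total0 (Suc d) (\<lambda>n x. ennreal (t \<psi> n x)) = 1" for d
    using total0_stop_sum[OF \<psi>, of "Suc 0" 0 "\<lambda>_. 1" d] total0_t_single[of \<psi>] by simp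
  have "?S d \<le> 1" for d
    by (rule order.trans[OF _ eq_refl[OF eq[of d]]]) simp
  then have "?S d \<noteq> top" for d
    by (rule neq_top_trans[OF ennreal_one_neq_top])
  then have "total0 (Suc d) (\<lambda>n x. ennreal (t \<psi> n x)) = 1 - ?S d" for d
    unfolding eq[of d, symmetric] by (intro ennreal_add_diff_cancel_left[symmetric])
  moreover have "(\<lambda>d. 1 - ?S d) \<longlonglongrightarrow> 1 - 1"
    using summable_LIMSEQ[of "\<lambda>j. total0 (Suc j) (\<lambda>n x. ennreal (s \<psi> n x))"] sum
    by (intro tendsto_diff_ennreal tendsto_const) auto
  ultimately show ?thesis
    by (subst filterlim_sequentially_Suc[symmetric]) simp
qed

text \<open>
  If only finitely many \<open>n\<close> are charged, the costs are bounded, so the remainder of the telescoping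
  sum is at most a constant times the probability of reaching stage \<open>k + d\<close>, which tends to 0.
\<close>

lemma total0_t_cost_le:
  assumes \<psi>0: "\<psi> \<in> stopping_rules0" and k: "k \<ge> 1"
  shows "total0 k (\<lambda>n x. ennreal (t \<psi> n x) * ennreal (cost n)) \<le>
    (\<Sum>j. total0 (k + j) (\<lambda>n x. ennreal (s \<psi> n x) * ennreal (cost n)))" (is "_ \<le> ?X")
proof (rule total_le_finite)
  fix A assume A: "finite A" "A \<subseteq> sizes k"
  have \<psi>: "is_rule \<psi>" using \<psi>0 by (auto simp: stopping_rules0_iff)
  define w where "w n = indicator A n * ennreal (cost n)" for n
  \<comment> \<open>For empty \<open>A\<close> the maximum is unspecified, but \<open>w\<close> is
    then 0 and \<open>C\<close> is still finite. Finiteness of \<open>C\<close> is what sends the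
    remainder to 0.\<close>
  define C where "C = ennreal (Max (cost ` A))"
  have C: "C < \<infinity>" by (simp add: C_def)
  have wC: "w n \<le> C" for n
    using A(1) by (auto simp: w_def C_def intro!: ennreal_leI split: split_indicator)
  let ?r = "\<lambda>d. total0 (k + d) (\<lambda>n x. ennreal (t \<psi> n x))"
  have le: "total0 k (\<lambda>n x. ennreal (t \<psi> n x) * w (take k n)) \<le> ?X + C * ?r d" for d
  proof -
    have "total0 k (\<lambda>n x. ennreal (t \<psi> n x) * w (take k n)) =
        (\<Sum>j<d. total0 (k + j) (\<lambda>n x. ennreal (s \<psi> n x) * w (take k n))) +
        total0 (k + d) (\<lambda>n x. ennreal (t \<psi> n x) * w (take k n))"
      using total0_stop_sum[OF \<psi> k order.refl] by simp
    also have "\<dots> \<le> (\<Sum>j<d. total0 (k + j) (\<lambda>n x. ennreal (s \<psi> n x) * ennreal (cost n))) +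
        total0 (k + d) (\<lambda>n x. C * ennreal (t \<psi> n x))"
    \<comment> \<open>In the stopped terms the prefix cost is enlarged to the full cost, as costs
      are positive; only the remainder uses the bound \<open>C\<close>.\<close>
    proof (intro add_mono sum_mono total0_mono)
      fix j n and x :: "'a data" assume n: "n \<in> sizes (k + j)"
      have "w (take k n) \<le> ennreal (cost (take k n))"
        by (simp add: w_def split: split_indicator)
      also have "\<dots> \<le> ennreal (cost n)"
        using n by (intro ennreal_leI cost_take_le) auto
      finally show "ennreal (s \<psi> n x) * w (take k n) \<le> ennreal (s \<psi> n x) * ennreal (cost n)"
        by (rule mult_left_mono) simp
    next
      fix n and x :: "'a data"
      show "ennreal (t \<psi> n x) * w (take k n) \<le> C * ennreal (t \<psi> n x)"
        using wC by (subst mult.commute) (intro mult_right_mono, auto)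
    qed
    also have "\<dots> \<le> ?X + C * ?r d"
      using t_measurable[OF \<psi>] by (subst total0_cmult) (auto intro!: add_mono sum_le_suminf adaptedI)
    finally show ?thesis .
  qed
  have "?r \<longlonglongrightarrow> 0"
    using total0_t_tendsto_0[OF \<psi>0] LIMSEQ_ignore_initial_segment[of _ 0 k]
    by (simp add: add.commute)
  then have "(\<lambda>d. ?X + C * ?r d) \<longlonglongrightarrow> ?X + C * 0"
    using C by (intro tendsto_add tendsto_const ennreal_tendsto_cmult) auto
  then have "total0 k (\<lambda>n x. ennreal (t \<psi> n x) * w (take k n)) \<le> ?X + C * 0"
    using le by (intro LIMSEQ_le_const) auto
  moreover have "total k (\<lambda>n x. indicator A n * (ennreal (t \<psi> n x) * ennreal (cost n) * ennreal (dens f0 n x))) =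
      total0 k (\<lambda>n x. ennreal (t \<psi> n x) * w (take k n))"
    by (intro total_cong) (simp add: w_def length_sizes mult_ac)
  ultimately show "total k (\<lambda>n x. indicator A n * (ennreal (t \<psi> n x) * ennreal (cost n) * ennreal (dens f0 n x))) \<le> ?X"
    by simp
qed

lemma total0_t_cost_tendsto_0:
  assumes \<psi>: "\<psi> \<in> stopping_rules0" and "K0 \<psi> < \<infinity>"
  shows "(\<lambda>k. total0 (Suc k) (\<lambda>n x. ennreal (t \<psi> n x) * ennreal (cost n))) \<longlonglongrightarrow> 0"
proof -
  let ?f = "\<lambda>k. total0 (Suc k) (\<lambda>n x. ennreal (s \<psi> n x) * ennreal (cost n))"
  have "(\<Sum>k. ?f k) < \<infinity>"
    using assms by (simp add: K0_eq stopping_rules0_iff)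
  then have lim: "(\<lambda>k. \<Sum>j. ?f (j + k)) \<longlonglongrightarrow> 0"
    by (rule ennreal_suminf_tail_tendsto_0)
  have le: "total0 (Suc k) (\<lambda>n x. ennreal (t \<psi> n x) * ennreal (cost n)) \<le> (\<Sum>j. ?f (j + k))" for k
    using total0_t_cost_le[OF \<psi>, of "Suc k"] by (simp add: add.commute)
  show ?thesis
    by (rule tendsto_sandwich[OF always_eventually always_eventually tendsto_const lim]) (simp_all add: le)
qed

subsection \<open>Optimal stopping and decision\<close>

context
  fixes l0 l1 :: real
  assumes l0: "0 < l0" and l1: "0 < l1"
begin

text \<open>This is R_k of the idea above: accumulated cost plus optimal future loss, over the paths
  that reach stage \<open>k\<close>.\<close>

abbreviation alive :: "'a rule \<Rightarrow> nat \<Rightarrow> ennreal" where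
  "alive \<psi> k \<equiv> total0 k (\<lambda>n x. ennreal (t \<psi> n x) * (ennreal (cost n) + Vlim l0 l1 k (z n x)))"

abbreviation stopped :: "'a rule \<Rightarrow> nat \<Rightarrow> ennreal" where
  "stopped \<psi> k \<equiv> total0 k (\<lambda>n x. ennreal (s \<psi> n x) * (ennreal (cost n) + g l0 l1 (z n x)))"

text \<open>The integrand of \<open>alive\<close> with the minimum of the Bellman equation replaced
  by the mixture that the rule \<psi> actually realises.\<close>

definition step_value :: "'a rule \<Rightarrow> nat \<Rightarrow> nat list \<Rightarrow> 'a data \<Rightarrow> ennreal" where
  "step_value \<psi> k n x = ennreal (t \<psi> n x * \<psi> n x) * (ennreal (cost n) + g l0 l1 (z n x)) +
    ennreal (t \<psi> n x * (1 - \<psi> n x)) *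
      (ennreal (cost n) + (mean_c (Suc k) + Vbar l0 l1 (Suc k) (z n x)))"

text \<open>The continuation part of the mixture, read backwards through the dynamic programming
  step, is the value carried to stage \<open>k + 1\<close>.\<close>

lemma total0_step_value:
  assumes \<psi>: "is_rule \<psi>" and k: "k \<ge> 1"
  shows "total0 k (step_value \<psi> k) = stopped \<psi> k + alive \<psi> (Suc k)"
proof -
  let ?u = "\<lambda>n x. ennreal (t \<psi> n x * (1 - \<psi> n x))"
  let ?c = "\<lambda>n x. ?u n x * (ennreal (cost n) + (mean_c (Suc k) + avg (Suc k) (Vlim l0 l1 (Suc k)) (z n x)))"
  note m = t_measurable[OF \<psi>] s_measurable[OF \<psi>] rule_measurable[OF \<psi>]
  have u: "adapted k ?u"
    using m k by (intro adaptedI) auto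
  have "alive \<psi> (Suc k) = total0 (Suc k) (\<lambda>n x. ?u (take k n) (restrict x {..<k}) *
      (ennreal (cost n) + Vlim l0 l1 (Suc k) (z n x)))"
    using k by (intro total_cong) (simp add: t_Suc)
  also have "\<dots> = total0 k ?c"
    by (rule total0_Suc_cost[OF u Vlim_measurable])
  finally have "stopped \<psi> k + alive \<psi> (Suc k) = total0 k (\<lambda>n x.
      ennreal (s \<psi> n x) * (ennreal (cost n) + g l0 l1 (z n x)) + ?c n x)"
    using m k u by (subst total0_add) (auto intro!: adaptedI dest: adaptedD)
  then show ?thesis
    by (simp add: step_value_def[abs_def] Vbar_eq s_def)
qed

lemma alive_le_step_value:
  assumes "is_rule \<psi>" "k \<ge> 1" "n \<in> sizes k" "x \<in> space (mu n)"
  shows "ennreal (t \<psi> n x) * (ennreal (cost n) + Vlim l0 l1 k (z n x)) \<le> step_value \<psi> k n x"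
  unfolding step_value_def Vlim_eq
  using t_bounds[OF assms(1,3,4)] rule_bounds[OF assms(1,3,2,4)] by (intro min_le_mix)

lemma alive_eq_step_value_iff:
  assumes "is_rule \<psi>" "k \<ge> 1" "n \<in> sizes k" "x \<in> space (mu n)"
  shows "ennreal (t \<psi> n x) * (ennreal (cost n) + Vlim l0 l1 k (z n x)) = step_value \<psi> k n x \<longleftrightarrow>
    (0 < t \<psi> n x \<longrightarrow>
      between_ind (\<psi> n x) (g l0 l1 (z n x)) (mean_c (Suc k) + Vbar l0 l1 (Suc k) (z n x)))"
proof (cases "t \<psi> n x = 0")
  case True
  then show ?thesis by (simp add: step_value_def)
next
  case False
  then have t: "0 < t \<psi> n x"
    using t_bounds[OF assms(1,3,4)] by simp
  \<comment> \<open>Both alternatives must be finite for the equality criterion; the value functions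
    are bounded by \<open>l0\<close>, the loss of always rejecting.\<close>
  have "Vbar l0 l1 (Suc k) (z n x) \<le> avg (Suc k) (\<lambda>_. ennreal l0) (z n x)"
    by (subst Vbar_eq) (auto intro!: avg_mono Vlim_le)
  also have "\<dots> < \<infinity>" by (simp add: avg_const)
  finally have "mean_c (Suc k) + Vbar l0 l1 (Suc k) (z n x) < \<infinity>"
    using mean_c_finite[of "Suc k"] by simp
  moreover have "g l0 l1 (z n x) < \<infinity>"
    by (rule le_less_trans[OF g_le]) simp
  ultimately show ?thesis
    unfolding step_value_def Vlim_eq
    using t rule_bounds[OF assms(1,3,2,4)] by (subst min_eq_mix_iff) auto
qed

lemma step_value_measurable:
  assumes "is_rule \<psi>" "k \<ge> 1" "n \<in> sizes k"
  shows "step_value \<psi> k n \<in> borel_measurable (mu n)"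
proof -
  note [measurable] = t_measurable[OF assms(1,3)] rule_measurable[OF assms(1,3,2)]
  have [measurable]: "Vbar l0 l1 (Suc k) \<in> borel_measurable borel"
    by (rule Vbar_measurable) simp
  show ?thesis unfolding step_value_def[abs_def] by measurable
qed

lemma alive_le_Suc:
  assumes "is_rule \<psi>" "k \<ge> 1"
  shows "alive \<psi> k \<le> stopped \<psi> k + alive \<psi> (Suc k)"
  unfolding total0_step_value[OF assms, symmetric]
  using alive_le_step_value[OF assms] by (rule total0_mono)

text \<open>Multiplying by the density and by \<open>t\<close> encodes the restriction to the points
  of \<open>T_set\<close> with positive null density: off these points both sides vanish.\<close>

lemma cond_S_iff_value_eq_AE:
  assumes \<psi>: "is_rule \<psi>"
  shows "cond_S l0 l1 \<psi> \<longleftrightarrow> (\<forall>k\<ge>1. \<forall>n\<in>pos_sizes k. AE x in mu n.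
    ennreal (t \<psi> n x) * (ennreal (cost n) + Vlim l0 l1 k (z n x)) * ennreal (dens f0 n x) =
    step_value \<psi> k n x * ennreal (dens f0 n x))"
proof -
  have "(x \<in> T_set \<psi> n \<and> dens f0 n x > 0 \<longrightarrow>
        between_ind (\<psi> n x) (g l0 l1 (z n x)) (mean_c (Suc k) + Vbar l0 l1 (Suc k) (z n x))) \<longleftrightarrow>
      ennreal (t \<psi> n x) * (ennreal (cost n) + Vlim l0 l1 k (z n x)) * ennreal (dens f0 n x) =
      step_value \<psi> k n x * ennreal (dens f0 n x)"
    if "k \<ge> 1" "n \<in> pos_sizes k" "x \<in> space (mu n)" for k n x
  proof (cases "dens f0 n x = 0")
    case False
    then have "0 < dens f0 n x"
      using that by (simp add: less_le)
    moreover have "n \<in> sizes k"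
      using that by (simp add: pos_sizes_def)
    ultimately show ?thesis
      using alive_eq_step_value_iff[OF \<psi> that(1) _ that(3)] that(3)
        ennreal_mult_cancel_left[of "ennreal (dens f0 n x)"
          "ennreal (t \<psi> n x) * (ennreal (cost n) + Vlim l0 l1 k (z n x))" "step_value \<psi> k n x"]
      by (simp add: T_set_def mult.commute[of _ "ennreal (dens f0 n x)"])
  qed simp
  then show ?thesis
    unfolding cond_S_def as_on_def by (intro all_cong ball_cong refl AE_cong) auto
qed

lemma cond_S_value_Suc:
  assumes "is_rule \<psi>" "cond_S l0 l1 \<psi>" "k \<ge> 1"
  shows "alive \<psi> k = stopped \<psi> k + alive \<psi> (Suc k)"
  unfolding total0_step_value[OF assms(1,3), symmetric]
  using assms cond_S_iff_value_eq_AE[of \<psi>] by (intro total_cong_AE) auto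

text \<open>No decision has been taken before the first group is seen. Hence this value is a common
  benchmark for all tests.\<close>

lemma alive_single_eq: "alive \<psi> (Suc 0) = alive \<psi>' (Suc 0)"
  by (intro total_cong) (simp add: t_single)

lemma alive_single_finite: "alive \<psi> (Suc 0) < \<infinity>"
proof -
  have "alive \<psi> (Suc 0) = total0 (Suc 0) (\<lambda>n x. 1 * (ennreal (cost n) + Vlim l0 l1 (Suc 0) (z n x)))"
    by (intro total_cong) (simp add: t_single)
  also have "\<dots> = total0 0 (\<lambda>n x. 1 * (ennreal (cost n) + (mean_c (Suc 0) + avg (Suc 0) (Vlim l0 l1 (Suc 0)) (z n x))))"
    by (rule total0_Suc_cost[of 0 "\<lambda>_ _. 1"]) (auto simp: adapted_def)
  also have "\<dots> \<le> total0 0 (\<lambda>n x. mean_c (Suc 0) + ennreal l0)"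
  proof (rule total0_mono)
    fix n x assume "n \<in> sizes 0"
    then have "cost n = 0" by (simp add: cost_def length_sizes)
    moreover have "avg (Suc 0) (Vlim l0 l1 (Suc 0)) (z n x) \<le> ennreal l0"
      using avg_mono[of "Vlim l0 l1 (Suc 0)" "\<lambda>_. ennreal l0" "Suc 0" "z n x"] Vlim_le by (simp add: avg_const)
    ultimately show "1 * (ennreal (cost n) + (mean_c (Suc 0) + avg (Suc 0) (Vlim l0 l1 (Suc 0)) (z n x)))
        \<le> mean_c (Suc 0) + ennreal l0"
      by (simp add: add_left_mono)
  qed
  also have "\<dots> < \<infinity>"
    using mean_c_finite[of "Suc 0"] by (simp add: total0_0_const)
  finally show ?thesis .
qed

text \<open>Under the stopping condition the one-step inequalities are equalities and telescope; the
  nonnegative remainder is dropped.\<close>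

lemma stopped_sum_le_alive:
  assumes "is_rule \<psi>" "cond_S l0 l1 \<psi>"
  shows "(\<Sum>k. stopped \<psi> (Suc k)) \<le> alive \<psi> (Suc 0)"
proof -
  have eq: "(\<Sum>k<d. stopped \<psi> (Suc k)) + alive \<psi> (Suc d) = alive \<psi> (Suc 0)" for d
  proof (induction d)
    case (Suc d)
    with cond_S_value_Suc[OF assms, of "Suc d"] show ?case by (simp add: add.assoc)
  qed simp
  have "(\<Sum>k<d. stopped \<psi> (Suc k)) \<le> alive \<psi> (Suc 0)" for d
    by (rule order.trans[OF _ eq_refl[OF eq[of d]]]) simp
  then show ?thesis by (intro suminf_le_const) auto
qed

text \<open>The future loss is at most \<open>l0\<close> times the probability of getting this far,
  and the accumulated cost is bounded by a tail of the finite mean cost.\<close>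

lemma alive_tendsto_0:
  assumes \<psi>: "\<psi> \<in> stopping_rules0" and "K0 \<psi> < \<infinity>"
  shows "(\<lambda>k. alive \<psi> (Suc k)) \<longlonglongrightarrow> 0"
proof -
  let ?t = "\<lambda>k. total0 k (\<lambda>n x. ennreal (t \<psi> n x))"
  let ?c = "\<lambda>k. total0 k (\<lambda>n x. ennreal (t \<psi> n x) * ennreal (cost n))"
  have \<psi>': "is_rule \<psi>" using \<psi> by (simp add: stopping_rules0_iff)
  note m = t_measurable[OF \<psi>']
  have le: "alive \<psi> k \<le> ?c k + ennreal l0 * ?t k" for k
  proof -
    have "alive \<psi> k \<le> total0 k (\<lambda>n x. ennreal (t \<psi> n x) * ennreal (cost n) + ennreal l0 * ennreal (t \<psi> n x))"
      unfolding distrib_left mult.commute[of "ennreal l0"]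
      using Vlim_le by (intro total0_mono add_left_mono mult_left_mono) auto
    also have "\<dots> = ?c k + ennreal l0 * ?t k"
      using m by (subst total0_add, (auto intro!: adaptedI)[2], subst total0_cmult) (auto intro!: adaptedI)
    finally show ?thesis .
  qed
  have "(\<lambda>k. ?c (Suc k) + ennreal l0 * ?t (Suc k)) \<longlonglongrightarrow> 0 + ennreal l0 * 0"
    using total0_t_cost_tendsto_0[OF assms] LIMSEQ_Suc[OF total0_t_tendsto_0[OF \<psi>]]
    by (intro tendsto_add ennreal_tendsto_cmult) auto
  then have lim: "(\<lambda>k. ?c (Suc k) + ennreal l0 * ?t (Suc k)) \<longlonglongrightarrow> 0" by simp
  show ?thesis
    by (rule tendsto_sandwich[OF always_eventually always_eventually tendsto_const lim]) (simp_all add: le)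
qed

text \<open>The one-step inequalities make \<open>X\<close> increase from the benchmark to the total
  stopped loss. If the two ends agree, \<open>X\<close> is constant; being finite, its earlier terms
  cancel, and equality holds at every stage.\<close>

lemma
  assumes \<psi>: "\<psi> \<in> stopping_rules0" and K0: "K0 \<psi> < \<infinity>"
  shows alive_le_stopped_sum: "alive \<psi> (Suc 0) \<le> (\<Sum>k. stopped \<psi> (Suc k))"
    and alive_eq_stopped_sum_imp_cond_S:
      "(\<Sum>k. stopped \<psi> (Suc k)) = alive \<psi> (Suc 0) \<Longrightarrow> cond_S l0 l1 \<psi>"
proof -
  let ?A = "\<Sum>k. stopped \<psi> (Suc k)"
  \<comment> \<open>The loss when \<psi> governs the first \<open>d\<close> stages and the value
    function accounts for the rest.\<close>
  define X where "X d = (\<Sum>k<d. stopped \<psi> (Suc k)) + alive \<psi> (Suc d)" for d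
  have \<psi>': "is_rule \<psi>" using \<psi> by (simp add: stopping_rules0_iff)
  have X_Suc: "X (Suc d) = (\<Sum>k<d. stopped \<psi> (Suc k)) + (stopped \<psi> (Suc d) + alive \<psi> (Suc (Suc d)))" for d
    by (simp add: X_def add.assoc)
  have inc: "incseq X"
    unfolding X_Suc[abs_def] incseq_Suc_iff
    using alive_le_Suc[OF \<psi>'] by (auto simp: X_Suc X_def intro!: add_left_mono)
  have "(\<lambda>d. (\<Sum>k<d. stopped \<psi> (Suc k)) + alive \<psi> (Suc d)) \<longlonglongrightarrow> ?A + 0"
    by (intro tendsto_add summable_LIMSEQ alive_tendsto_0 assms) auto
  then have "X \<longlonglongrightarrow> ?A" by (simp add: X_def[abs_def])
  then have X_le: "X d \<le> ?A" for d using inc by (intro incseq_le)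
  have X_0: "X 0 = alive \<psi> (Suc 0)" by (simp add: X_def)
  show "alive \<psi> (Suc 0) \<le> ?A" using X_le[of 0] X_0 by simp
  assume eq: "?A = alive \<psi> (Suc 0)"
  have X_eq: "X d = alive \<psi> (Suc 0)" for d
    using X_le[of d] incseqD[OF inc, of 0 d] X_0 eq by simp
  have fin: "X d < \<infinity>" for d
    unfolding X_eq by (rule alive_single_finite)
  have alive_Suc: "alive \<psi> k = total0 k (step_value \<psi> k) \<and> alive \<psi> k < \<infinity>" if "k \<ge> 1" for k
  proof -
    obtain d where d: "k = Suc d" using \<open>k \<ge> 1\<close> by (cases k) auto
    have "(\<Sum>k<d. stopped \<psi> (Suc k)) + alive \<psi> (Suc d) =
        (\<Sum>k<d. stopped \<psi> (Suc k)) + (stopped \<psi> (Suc d) + alive \<psi> (Suc (Suc d)))"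
      using X_eq[of d] X_eq[of "Suc d"] unfolding X_Suc by (simp add: X_def)
    moreover have "(\<Sum>k<d. stopped \<psi> (Suc k)) < \<infinity>" "alive \<psi> (Suc d) < \<infinity>"
      by (rule le_less_trans[OF _ fin[of d]], simp add: X_def)+
    ultimately have "alive \<psi> (Suc d) = stopped \<psi> (Suc d) + alive \<psi> (Suc (Suc d))" "alive \<psi> (Suc d) < \<infinity>"
      by (auto simp only: ennreal_add_left_cancel less_irrefl)
    then show ?thesis
      unfolding d using total0_step_value[OF \<psi>', of "Suc d"] by simp
  qed
  show "cond_S l0 l1 \<psi>"
    unfolding cond_S_iff_value_eq_AE[OF \<psi>']
  proof (intro allI impI ballI total_eq_imp_AE_eq)
    fix k :: nat and n assume "k \<ge> 1" "n \<in> pos_sizes k"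
    then show "adapted k (\<lambda>n x. step_value \<psi> k n x * ennreal (dens f0 n x))"
      "adapted k (\<lambda>n x. ennreal (t \<psi> n x) * (ennreal (cost n) + Vlim l0 l1 k (z n x)) * ennreal (dens f0 n x))"
      using step_value_measurable[OF \<psi>'] t_measurable[OF \<psi>']
      by (auto intro!: adaptedI borel_measurable_times_ennreal)
    show "alive \<psi> k = total0 k (step_value \<psi> k)" "alive \<psi> k < \<infinity>"
      using alive_Suc[OF \<open>k \<ge> 1\<close>] by fast+
    show "ennreal (t \<psi> n x) * (ennreal (cost n) + Vlim l0 l1 k (z n x)) * ennreal (dens f0 n x)
      \<le> step_value \<psi> k n x * ennreal (dens f0 n x)" if "n \<in> sizes k" "x \<in> space (mu n)" for n x
      using alive_le_step_value[OF \<psi>' \<open>k \<ge> 1\<close> that] by (rule mult_right_mono) simp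
  qed
qed

section \<open>Losses from the terminal decision\<close>

abbreviation cost_term :: "nat list \<Rightarrow> 'a data \<Rightarrow> ennreal" where
  "cost_term n x \<equiv> ennreal (cost n) * ennreal (dens f0 n x)"

abbreviation loss0 :: "nat list \<Rightarrow> 'a data \<Rightarrow> ennreal" where
  "loss0 n x \<equiv> ennreal (l0 * dens f0 n x)"

abbreviation loss1 :: "nat list \<Rightarrow> 'a data \<Rightarrow> ennreal" where
  "loss1 n x \<equiv> ennreal (l1 * dens f1 n x)"

text \<open>Losses are written with the densities themselves instead of with \<open>z\<close>, since
  data having null density 0 still contribute to the type II error.\<close>

definition decision_loss :: "'a rule \<Rightarrow> 'a rule \<Rightarrow> nat list \<Rightarrow> 'a data \<Rightarrow> ennreal" where
  "decision_loss \<psi> \<phi> n x = ennreal (s \<psi> n x * \<phi> n x) * (cost_term n x + loss0 n x) +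
    ennreal (s \<psi> n x * (1 - \<phi> n x)) * (cost_term n x + loss1 n x)"

definition stop_loss :: "'a rule \<Rightarrow> nat list \<Rightarrow> 'a data \<Rightarrow> ennreal" where
  "stop_loss \<psi> n x = ennreal (s \<psi> n x) * (cost_term n x + min (loss0 n x) (loss1 n x))"

lemma g_z_dens:
  assumes x: "x \<in> space (mu n)"
  shows "g l0 l1 (z n x) * ennreal (dens f0 n x) = min (loss0 n x) (loss1 n x)"
proof (cases "dens f0 n x = 0")
  case False
  then have d: "0 < dens f0 n x" using f0_dens_nonneg[OF x] by (simp add: less_le)
  then have "g l0 l1 (z n x) = ennreal (min l0 (l1 * (dens f1 n x / dens f0 n x)))"
    using f1_dens_nonneg[OF x] l0 l1
    by (auto simp: g_def z_def ennreal_mult[symmetric] min_def ennreal_le_iff2 not_le)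
  moreover have "min l0 (l1 * (dens f1 n x / dens f0 n x)) * dens f0 n x = min (l0 * dens f0 n x) (l1 * dens f1 n x)"
    using d by (auto simp: min_def field_simps)
  ultimately show ?thesis
    using d f1_dens_nonneg[OF x] l0 l1
    by (auto simp: ennreal_mult'[symmetric] min_def ennreal_le_iff2 not_le)
qed simp

lemma stopped_eq_stop_loss: "stopped \<psi> k = total k (stop_loss \<psi>)"
  unfolding stop_loss_def by (intro total_cong) (simp add: distrib_right mult.assoc g_z_dens)

text \<open>Comparing \<open>z\<close> with \<open>l0 / l1\<close> means comparing the two losses
  after clearing denominators. If only the null density is 0, \<open>z\<close> is infinite and
  \<open>loss0 = 0 < loss1\<close>, so both sides demand rejection. If both densities were 0, the
  losses would tie while \<open>z\<close> is a mere convention.\<close>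

lemma between_ind_z_iff:
  assumes x: "x \<in> space (mu n)" and pos: "dens f0 n x > 0 \<or> dens f1 n x > 0"
  shows "between_ind q (ennreal (l0 / l1)) (z n x) \<longleftrightarrow> between_ind q (loss0 n x) (loss1 n x)"
proof -
  let ?d0 = "dens f0 n x" and ?d1 = "dens f1 n x"
  have d: "0 \<le> ?d0" "0 \<le> ?d1" using x by auto
  have "(ennreal (l0 / l1) < z n x \<longleftrightarrow> loss0 n x < loss1 n x) \<and>
    (ennreal (l0 / l1) \<le> z n x \<longleftrightarrow> loss0 n x \<le> loss1 n x)"
  proof (cases "?d0 = 0")
    case True
    then have "0 < l1 * ?d1" using pos l1 by simp
    then show ?thesis using True pos by (simp add: z_def less_top[symmetric])
  next
    case False
    then have "0 < ?d0" using d by simp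
    then show ?thesis
      using d l0 l1 by (simp add: z_def ennreal_less_iff ennreal_le_iff field_simps)
  qed
  then show ?thesis by (simp add: between_ind_def)
qed

lemma stop_loss_le:
  assumes "is_rule \<psi>" "is_rule \<phi>" "k \<ge> 1" "n \<in> sizes k" "x \<in> space (mu n)"
  shows "stop_loss \<psi> n x \<le> decision_loss \<psi> \<phi> n x"
  unfolding stop_loss_def decision_loss_def
  using s_nonneg[OF assms(1,4,3,5)] rule_bounds[OF assms(2,4,3,5)] by (intro min_le_mix)

lemma total_stop_loss_le:
  assumes "is_rule \<psi>" "is_rule \<phi>"
  shows "total (Suc k) (stop_loss \<psi>) \<le> total (Suc k) (decision_loss \<psi> \<phi>)"
  using stop_loss_le[OF assms, of "Suc k"] by (intro total_mono) simp

lemma stop_loss_eq_iff: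
  assumes "is_rule \<psi>" "is_rule \<phi>" "k \<ge> 1" "n \<in> sizes k" and x: "x \<in> space (mu n)"
  shows "stop_loss \<psi> n x = decision_loss \<psi> \<phi> n x \<longleftrightarrow>
    (x \<in> S_set \<psi> n \<and> (dens f0 n x > 0 \<or> dens f1 n x > 0) \<longrightarrow>
      between_ind (\<phi> n x) (ennreal (l0 / l1)) (z n x))"
proof (cases "s \<psi> n x > 0 \<and> (dens f0 n x > 0 \<or> dens f1 n x > 0)")
  case True
  have "stop_loss \<psi> n x = decision_loss \<psi> \<phi> n x \<longleftrightarrow> between_ind (\<phi> n x) (loss0 n x) (loss1 n x)"
    unfolding stop_loss_def decision_loss_def
    using True rule_bounds[OF assms(2,4,3,5)]
    by (intro min_eq_mix_iff) (auto simp: ennreal_mult_less_top)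
  then show ?thesis
    using True x by (simp add: between_ind_z_iff S_set_def)
next
  case False
  then have "s \<psi> n x = 0 \<or> dens f0 n x = 0 \<and> dens f1 n x = 0"
    using s_nonneg[OF assms(1,4,3,5)] f0_dens_nonneg[OF x] f1_dens_nonneg[OF x] by auto
  then have "stop_loss \<psi> n x = decision_loss \<psi> \<phi> n x"
    by (auto simp: stop_loss_def decision_loss_def)
  then show ?thesis using False by (auto simp: S_set_def)
qed

text \<open>The conditions for \<open>f0\<close> and \<open>f1\<close> together cover the points
  where at least one density is positive, which are exactly those where a wrong decision costs
  something.\<close>

lemma cond_D_iff_stop_loss_eq_AE:
  assumes "is_rule \<psi>" "is_rule \<phi>"
  shows "cond_D f0 l0 l1 \<psi> \<phi> \<and> cond_D f1 l0 l1 \<psi> \<phi> \<longleftrightarrow>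
    (\<forall>k\<ge>1. \<forall>n\<in>pos_sizes k. AE x in mu n. stop_loss \<psi> n x = decision_loss \<psi> \<phi> n x)"
proof -
  have "(AE x in mu n. stop_loss \<psi> n x = decision_loss \<psi> \<phi> n x) \<longleftrightarrow>
      (AE x in mu n. (x \<in> S_set \<psi> n \<and> dens f0 n x > 0 \<longrightarrow> between_ind (\<phi> n x) (ennreal (l0 / l1)) (z n x)) \<and>
        (x \<in> S_set \<psi> n \<and> dens f1 n x > 0 \<longrightarrow> between_ind (\<phi> n x) (ennreal (l0 / l1)) (z n x)))"
    if "k \<ge> 1" "n \<in> pos_sizes k" for k n
    using stop_loss_eq_iff[OF assms that(1)] that(2)
    by (intro AE_cong) (auto simp: pos_sizes_def)
  then show ?thesis
    unfolding cond_D_def as_on_def by (auto simp: AE_conj_iff)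
qed

lemma loss_measurable:
  assumes "is_rule \<psi>" "is_rule \<phi>" "k \<ge> 1"
  shows "adapted k (stop_loss \<psi>)" "adapted k (decision_loss \<psi> \<phi>)"
proof -
  have "stop_loss \<psi> n \<in> borel_measurable (mu n) \<and> decision_loss \<psi> \<phi> n \<in> borel_measurable (mu n)"
    if n: "n \<in> sizes k" for n
  proof -
    note [measurable] = s_measurable[OF assms(1) n assms(3)] rule_measurable[OF assms(2) n assms(3)]
    show ?thesis
      unfolding stop_loss_def[abs_def] decision_loss_def[abs_def] by measurable
  qed
  then show "adapted k (stop_loss \<psi>)" "adapted k (decision_loss \<psi> \<phi>)"
    by (auto intro: adaptedI)
qed

section \<open>The Lagrangian combination of cost and errors, and its minimisation\<close>

definition risk :: "'a rule \<Rightarrow> 'a rule \<Rightarrow> ennreal" where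
  "risk \<psi> \<phi> = K0 \<psi> + ennreal l0 * \<alpha> \<psi> \<phi> + ennreal l1 * \<beta> \<psi> \<phi>"

lemma risk_eq:
  assumes \<psi>: "is_rule \<psi>" and \<phi>: "is_rule \<phi>"
  shows "risk \<psi> \<phi> = (\<Sum>k. total (Suc k) (decision_loss \<psi> \<phi>))"
proof -
  let ?c = "\<lambda>n x. ennreal (s \<psi> n x) * ennreal (cost n)"
  let ?a = "\<lambda>n x. ennreal (s \<psi> n x * \<phi> n x)"
  let ?b = "\<lambda>n x. ennreal (s \<psi> n x * (1 - \<phi> n x)) * ennreal (dens f1 n x)"
  have "total (Suc k) (decision_loss \<psi> \<phi>) =
      total0 (Suc k) ?c + ennreal l0 * total0 (Suc k) ?a + ennreal l1 * total (Suc k) ?b" for k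
  proof -
    note m = s_measurable[OF \<psi>] rule_measurable[OF \<phi>]
    have "total (Suc k) (decision_loss \<psi> \<phi>) = total (Suc k) (\<lambda>n x. ?c n x * ennreal (dens f0 n x) +
        ennreal l0 * (?a n x * ennreal (dens f0 n x)) + ennreal l1 * ?b n x)"
    proof (rule total_cong)
      fix n x assume n: "n \<in> sizes (Suc k)" and x: "x \<in> space (mu n)"
      have s: "0 \<le> s \<psi> n x" and f: "0 \<le> \<phi> n x" "\<phi> n x \<le> 1"
        using s_nonneg[OF \<psi> n _ x] rule_bounds[OF \<phi> n _ x] by auto
      \<comment> \<open>The cost occurs in both branches of \<open>decision_loss\<close>; their
        weights recombine to \<open>s\<close>.\<close>
      have "ennreal (s \<psi> n x) = ?a n x + ennreal (s \<psi> n x * (1 - \<phi> n x))"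
        using s f by (subst ennreal_plus[symmetric]) (auto simp: algebra_simps intro!: mult_left_le_one_le)
      then show "decision_loss \<psi> \<phi> n x = ?c n x * ennreal (dens f0 n x) +
          ennreal l0 * (?a n x * ennreal (dens f0 n x)) + ennreal l1 * ?b n x"
        using l0 l1 f0_dens_nonneg[OF x] f1_dens_nonneg[OF x]
        by (simp add: decision_loss_def ennreal_mult distrib_left distrib_right add_ac mult_ac)
    qed
    also have "\<dots> = total (Suc k) (\<lambda>n x. ?c n x * ennreal (dens f0 n x)) +
        total (Suc k) (\<lambda>n x. ennreal l0 * (?a n x * ennreal (dens f0 n x))) +
        total (Suc k) (\<lambda>n x. ennreal l1 * ?b n x)"
      using m by (subst total_add, (auto intro!: adaptedI)[2])+ simp
    also have "\<dots> = total0 (Suc k) ?c + ennreal l0 * total0 (Suc k) ?a + ennreal l1 * total (Suc k) ?b"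
      using m by (subst total_cmult, (auto intro!: adaptedI)[1])+ simp
    finally show ?thesis .
  qed
  then show ?thesis
    unfolding risk_def K0_eq[OF \<psi>] \<alpha>_eq \<beta>_eq
    by (simp add: suminf_add[symmetric])
qed

lemma stopped_sum_le_risk:
  assumes "is_rule \<psi>" "is_rule \<phi>"
  shows "(\<Sum>k. stopped \<psi> (Suc k)) \<le> risk \<psi> \<phi>"
  unfolding risk_eq[OF assms] stopped_eq_stop_loss
  using total_stop_loss_le[OF assms] by (intro suminf_le) auto

lemma cond_D_imp_risk_eq:
  assumes "is_rule \<psi>" "is_rule \<phi>" "cond_D f0 l0 l1 \<psi> \<phi>" "cond_D f1 l0 l1 \<psi> \<phi>"
  shows "risk \<psi> \<phi> = (\<Sum>k. stopped \<psi> (Suc k))"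
proof -
  have "total (Suc k) (decision_loss \<psi> \<phi>) = total (Suc k) (stop_loss \<psi>)" for k
    using cond_D_iff_stop_loss_eq_AE[OF assms(1,2)] assms(3,4)
    by (intro total_cong_AE[symmetric]) auto
  then show ?thesis
    unfolding risk_eq[OF assms(1,2)] stopped_eq_stop_loss by simp
qed

text \<open>Termwise domination and equal finite sums force equality at each stage, then almost
  everywhere for each size vector of positive probability.\<close>

lemma risk_eq_imp_cond_D:
  assumes "is_rule \<psi>" "is_rule \<phi>"
    and eq: "(\<Sum>k. stopped \<psi> (Suc k)) = risk \<psi> \<phi>" and fin: "risk \<psi> \<phi> < \<infinity>"
  shows "cond_D f0 l0 l1 \<psi> \<phi> \<and> cond_D f1 l0 l1 \<psi> \<phi>"
  unfolding cond_D_iff_stop_loss_eq_AE[OF assms(1,2)]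
proof (intro allI impI ballI)
  fix k n assume k: "(1::nat) \<le> k" and n: "n \<in> pos_sizes k"
  then obtain j where j: "k = Suc j" by (cases k) auto
  note le = total_stop_loss_le[OF assms(1,2)]
  have sum: "(\<Sum>k. total (Suc k) (stop_loss \<psi>)) = (\<Sum>k. total (Suc k) (decision_loss \<psi> \<phi>))"
    "(\<Sum>k. total (Suc k) (stop_loss \<psi>)) < \<infinity>"
    using eq fin unfolding risk_eq[OF assms(1,2)] stopped_eq_stop_loss by auto
  have "total (Suc j) (stop_loss \<psi>) \<le> (\<Sum>k. total (Suc k) (stop_loss \<psi>))"
    using sum_le_suminf[of "\<lambda>k. total (Suc k) (stop_loss \<psi>)" "{j}"] by simp
  then have "total k (stop_loss \<psi>) < \<infinity>"
    unfolding j using sum(2) by (rule le_less_trans)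
  then show "AE x in mu n. stop_loss \<psi> n x = decision_loss \<psi> \<phi> n x"
    using loss_measurable[OF assms(1,2) k] stop_loss_le[OF assms(1,2) k]
      ennreal_suminf_eq_imp_eq[OF le sum, of j] n j
    by (intro total_eq_imp_AE_eq) auto
qed

text \<open>The risk of the given test is at most the benchmark \<open>?v\<close>, which is at most
  the stopped loss and hence the risk of any competitor with finite mean cost. Subtracting the
  weighted error terms turns this into a comparison of mean costs.\<close>

lemma optimal_K0:
  assumes opt: "(\<psi>, \<phi>) \<in> tests0" "cond_S l0 l1 \<psi>" "cond_D f0 l0 l1 \<psi> \<phi>" "cond_D f1 l0 l1 \<psi> \<phi>"
    and test: "(\<psi>', \<phi>') \<in> tests0"
    and le: "\<alpha> \<psi>' \<phi>' \<le> \<alpha> \<psi> \<phi>" "\<beta> \<psi>' \<phi>' \<le> \<beta> \<psi> \<phi>"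
  shows "K0 \<psi> \<le> K0 \<psi>'"
    and "\<alpha> \<psi>' \<phi>' < \<alpha> \<psi> \<phi> \<or> \<beta> \<psi>' \<phi>' < \<beta> \<psi> \<phi> \<Longrightarrow> K0 \<psi> < K0 \<psi>'"
    and "\<alpha> \<psi>' \<phi>' = \<alpha> \<psi> \<phi> \<Longrightarrow> \<beta> \<psi>' \<phi>' = \<beta> \<psi> \<phi> \<Longrightarrow> K0 \<psi>' = K0 \<psi> \<Longrightarrow>
      cond_S l0 l1 \<psi>' \<and> cond_D f0 l0 l1 \<psi>' \<phi>' \<and> cond_D f1 l0 l1 \<psi>' \<phi>'"
proof -
  have rules: "\<psi> \<in> stopping_rules0" "is_rule \<psi>" "is_rule \<phi>"
      "\<psi>' \<in> stopping_rules0" "is_rule \<psi>'" "is_rule \<phi>'"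
    using opt(1) test by (auto simp: tests0_def stopping_rules0_iff)
  let ?v = "alive \<psi> (Suc 0)"
  have risk_le: "risk \<psi> \<phi> \<le> ?v"
    using cond_D_imp_risk_eq[OF rules(2,3) opt(3,4)] stopped_sum_le_alive[OF rules(2) opt(2)] by simp
  have fin: "risk \<psi> \<phi> < \<infinity>"
    using risk_le alive_single_finite by (rule le_less_trans)
  have *: "?v \<le> (\<Sum>k. stopped \<psi>' (Suc k))" if "K0 \<psi>' < \<infinity>"
    using alive_le_stopped_sum[OF rules(4) that] by (simp add: alive_single_eq[of \<psi>' \<psi>])
  have fins: "K0 \<psi> < \<infinity>" "\<alpha> \<psi> \<phi> < \<infinity>" "\<beta> \<psi> \<phi> < \<infinity>"
    using fin l0 l1 by (auto simp: risk_def ennreal_mult_less_top)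
  have "K0 \<psi> \<le> K0 \<psi>' \<and> (\<alpha> \<psi>' \<phi>' < \<alpha> \<psi> \<phi> \<or> \<beta> \<psi>' \<phi>' < \<beta> \<psi> \<phi> \<longrightarrow> K0 \<psi> < K0 \<psi>')"
  proof (cases "K0 \<psi>' < \<infinity>")
    \<comment> \<open>A competitor of infinite mean cost loses strictly, because the given test has
      finite risk.\<close>
    case False
    then show ?thesis using fins by (auto simp: not_less top_unique)
  next
    case True
    have "risk \<psi> \<phi> \<le> risk \<psi>' \<phi>'"
      using risk_le *[OF True] stopped_sum_le_risk[OF rules(5,6)] by (blast intro: order.trans)
    \<comment> \<open>All six quantities are finite, the competitor's errors by the constraints, so
      the risks can be subtracted as real numbers.\<close>
    moreover obtain a b k a' b' k' where eqs: "\<alpha> \<psi> \<phi> = ennreal a" "\<beta> \<psi> \<phi> = ennreal b" "K0 \<psi> = ennreal k"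
        "\<alpha> \<psi>' \<phi>' = ennreal a'" "\<beta> \<psi>' \<phi>' = ennreal b'" "K0 \<psi>' = ennreal k'"
      and nn: "0 \<le> a" "0 \<le> b" "0 \<le> k" "0 \<le> a'" "0 \<le> b'" "0 \<le> k'"
      using fins True le_less_trans[OF le(1) fins(2)] le_less_trans[OF le(2) fins(3)]
      by (cases "\<alpha> \<psi> \<phi>"; cases "\<beta> \<psi> \<phi>"; cases "K0 \<psi>"; cases "\<alpha> \<psi>' \<phi>'"; cases "\<beta> \<psi>' \<phi>'"; cases "K0 \<psi>'") auto
    ultimately have "k + l0 * a + l1 * b \<le> k' + l0 * a' + l1 * b'"
      using l0 l1 by (simp add: risk_def flip: ennreal_mult ennreal_plus)
    then have "l0 * (a - a') + l1 * (b - b') \<le> k' - k" by (simp add: algebra_simps)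
    moreover have ab: "a' \<le> a" "b' \<le> b" using le nn by (simp_all add: eqs)
    moreover have "0 \<le> l0 * (a - a')" "0 \<le> l1 * (b - b')"
      using ab l0 l1 by auto
    moreover have "a' < a \<Longrightarrow> 0 < l0 * (a - a')" "b' < b \<Longrightarrow> 0 < l1 * (b - b')"
      using l0 l1 by auto
    ultimately show ?thesis
      using nn by (auto simp: eqs ennreal_less_iff)
  qed
  then show "K0 \<psi> \<le> K0 \<psi>'" "\<alpha> \<psi>' \<phi>' < \<alpha> \<psi> \<phi> \<or> \<beta> \<psi>' \<phi>' < \<beta> \<psi> \<phi> \<Longrightarrow> K0 \<psi> < K0 \<psi>'"
    by auto
  assume eqs: "\<alpha> \<psi>' \<phi>' = \<alpha> \<psi> \<phi>" "\<beta> \<psi>' \<phi>' = \<beta> \<psi> \<phi>" "K0 \<psi>' = K0 \<psi>"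
  then have risk': "risk \<psi>' \<phi>' = risk \<psi> \<phi>" and K': "K0 \<psi>' < \<infinity>"
    using fins by (auto simp: risk_def)
  \<comment> \<open>With equal risks the chain of inequalities closes into a cycle. The first
    equality gives the stopping condition, the second the decision conditions.\<close>
  have sum_eq: "(\<Sum>k. stopped \<psi>' (Suc k)) = ?v" "(\<Sum>k. stopped \<psi>' (Suc k)) = risk \<psi>' \<phi>'"
    using *[OF K'] stopped_sum_le_risk[OF rules(5,6)] risk' risk_le by (auto intro: order.antisym)
  show "cond_S l0 l1 \<psi>' \<and> cond_D f0 l0 l1 \<psi>' \<phi>' \<and> cond_D f1 l0 l1 \<psi>' \<phi>'"
    using alive_eq_stopped_sum_imp_cond_S[OF rules(4) K'] risk_eq_imp_cond_D[OF rules(5,6)]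
      sum_eq risk' fin by (simp add: alive_single_eq[of \<psi>' \<psi>])
qed

end
end

theorem corollary4p2:
  fixes M :: "'a measure"
    and G :: "nat set"
    and p :: "nat \<Rightarrow> nat pmf"
    and f0 f1 :: "'a \<Rightarrow> real"
    and c :: "nat \<Rightarrow> real"
    and l0 l1 :: real
    and \<psi> \<phi> :: "'a rule"
  assumes "group_sequential M G p f0 f1 c"
    and "0 < l0" and "0 < l1"
    and "(\<psi>, \<phi>) \<in> group_sequential.tests0 M G p f0"
    and "group_sequential.cond_S M G p f0 f1 c l0 l1 \<psi>"
    and "group_sequential.cond_D M G p f0 f1 f0 l0 l1 \<psi> \<phi>"
    and "group_sequential.cond_D M G p f0 f1 f1 l0 l1 \<psi> \<phi>"
  shows "\<forall>\<psi>' \<phi>'.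
    (\<psi>', \<phi>') \<in> group_sequential.tests0 M G p f0 \<longrightarrow>
    group_sequential.\<alpha> M G p f0 \<psi>' \<phi>' \<le> group_sequential.\<alpha> M G p f0 \<psi> \<phi> \<longrightarrow>
    group_sequential.\<beta> M G p f1 \<psi>' \<phi>' \<le> group_sequential.\<beta> M G p f1 \<psi> \<phi> \<longrightarrow>
      group_sequential.K0 M G p f0 c \<psi>' \<ge> group_sequential.K0 M G p f0 c \<psi> \<and>
      (group_sequential.\<alpha> M G p f0 \<psi>' \<phi>' < group_sequential.\<alpha> M G p f0 \<psi> \<phi> \<or>
       group_sequential.\<beta> M G p f1 \<psi>' \<phi>' < group_sequential.\<beta> M G p f1 \<psi> \<phi> \<longrightarrow>
         group_sequential.K0 M G p f0 c \<psi>' > group_sequential.K0 M G p f0 c \<psi>) \<and>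
      (group_sequential.\<alpha> M G p f0 \<psi>' \<phi>' = group_sequential.\<alpha> M G p f0 \<psi> \<phi> \<and>
       group_sequential.\<beta> M G p f1 \<psi>' \<phi>' = group_sequential.\<beta> M G p f1 \<psi> \<phi> \<and>
       group_sequential.K0 M G p f0 c \<psi>' = group_sequential.K0 M G p f0 c \<psi> \<longrightarrow>
         group_sequential.cond_S M G p f0 f1 c l0 l1 \<psi>' \<and>
         group_sequential.cond_D M G p f0 f1 f0 l0 l1 \<psi>' \<phi>' \<and>
         group_sequential.cond_D M G p f0 f1 f1 l0 l1 \<psi>' \<phi>')"
proof -
  interpret group_sequential M G p f0 f1 c by fact
  show ?thesis
    using optimal_K0[OF assms(2-7)] by blast
qed

end
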